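(* Let $(Y_n)_{n\ge0}$ be a hidden Markov model on a discrete (countable) space $S$ with recurrent underlying Markov chain. Then, for each $y\in S$, the row $(V_{y,n})_{n\ge1}$ of the successors array of $(Y_n)$ is a hidden Markov model (with values in $S^*=S\cup\{\partial\}$) with recurrent underlying Markov chain.
   Context: Successors array: let $\partial\notin S$ and $S^*=S\cup\{\partial\}$. For $y\in S$, $n\ge1$, $V_{y,n}$ is the value of $Y$ immediately following the $n$-th visit of $Y$ to $y$ (visits counted from time $0$). If $Y$ visits $y$ only $m<\infty$ times, $V_{y,n}=\partial$ for all $n>m$. Hidden Markov model (HMM): a sequence $(Z_n)_{n\ge n_0}$ with values in a discrete space $R$ ($n_0=0$ for $Y$, with $R=S$; $n_0=1$ for the rows $V_{y,\cdot}$, with $R=S^*$) is an HMM if there is a pair of processes $(X_n,\widetilde Z_n)_{n\ge n_0}$ with values in $\mathcal X\times R$, $\mathcal X$ a discrete (countable) space, such that (1) $(X_n)$ is a time homogeneous Markov chain on $\mathcal X$ (the underlying Markov chain); (2) for all $N\ge n_0$ and $S_{n_0},\dots,S_N\subseteq R$, $\mathbb P(\widetilde Z_{n_0}\in S_{n_0},\dots,\widetilde Z_N\in S_N\mid X_{n_0}^N=x_{n_0}^N)=\prod_{n=n_0}^N\mathbb P(\widetilde Z_n\in S_n\mid X_n=x_n)$, where the read-out distributions $f_x(\bar S)=\mathbb P(\widetilde Z_n\in\bar S\mid X_n=x)$ do not depend on $n$; (3) $(Z_n)$ and $(\widetilde Z_n)$ have the same finite-dimensional distributions. Recurrence: a time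 homogeneous Markov chain $(X_n)_{n\ge n_0}$ is recurrent if $\mathbb P(X_n=x\text{ for infinitely many }n\mid X_{n_0}=x)=1$ for all $x\in\mathcal X$ with $\mathbb P(X_{n_0}=x)>0$; such chains visit no transient states, but may have more than one recurrence class. *)

theory Defs
  imports "HOL-Probability.Probability"
begin

section \<open>Discrete-time processes with values in countable spaces\<close>

text \<open>Countable spaces are types of class \<open>countable\<close> with the discrete sigma-algebra. A process
  started at time \<open>n0\<close> is a function on all of \<^typ>\<open>nat\<close>; its values before \<open>n0\<close> are
  irrelevant.\<close>

definition discrete_process ::
    "'a measure \<Rightarrow> nat \<Rightarrow> (nat \<Rightarrow> 'a \<Rightarrow> 'x::countable) \<Rightarrow> bool" where
  "discrete_process M n0 X \<longleftrightarrow>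
     prob_space M \<and> (\<forall>n\<ge>n0. X n \<in> M \<rightarrow>\<^sub>M count_space UNIV)"

definition homogeneous_markov_chain ::
    "'a measure \<Rightarrow> nat \<Rightarrow> (nat \<Rightarrow> 'a \<Rightarrow> 'x::countable) \<Rightarrow> bool" where
  "homogeneous_markov_chain M n0 X \<longleftrightarrow>
     discrete_process M n0 X \<and>
     (\<exists>K :: 'x \<Rightarrow> 'x pmf. \<forall>n\<ge>n0. \<forall>x :: nat \<Rightarrow> 'x. \<forall>x'.
        \<P>(\<omega> in M. \<forall>k\<in>{n0..n}. X k \<omega> = x k) > 0 \<longrightarrow>
        \<P>(\<omega> in M. X (Suc n) \<omega> = x' \<bar> \<forall>k\<in>{n0..n}. X k \<omega> = x k) = pmf (K (x n)) x')"

definition recurrent_chain ::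
    "'a measure \<Rightarrow> nat \<Rightarrow> (nat \<Rightarrow> 'a \<Rightarrow> 'x::countable) \<Rightarrow> bool" where
  "recurrent_chain M n0 X \<longleftrightarrow>
     (\<forall>x. \<P>(\<omega> in M. X n0 \<omega> = x) > 0 \<longrightarrow>
        \<P>(\<omega> in M. infinite {n. n0 \<le> n \<and> X n \<omega> = x} \<bar> X n0 \<omega> = x) = 1)"

definition same_finite_dim_distributions ::
    "nat \<Rightarrow> 'a measure \<Rightarrow> (nat \<Rightarrow> 'a \<Rightarrow> 'r::countable) \<Rightarrow> 'b measure \<Rightarrow> (nat \<Rightarrow> 'b \<Rightarrow> 'r) \<Rightarrow> bool" where
  "same_finite_dim_distributions n0 M Z N Z' \<longleftrightarrow>
     (\<forall>J. finite J \<and> J \<subseteq> {n0..} \<longrightarrow>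
        distr M (Pi\<^sub>M J (\<lambda>_. count_space UNIV)) (\<lambda>\<omega>. \<lambda>n\<in>J. Z n \<omega>) =
        distr N (Pi\<^sub>M J (\<lambda>_. count_space UNIV)) (\<lambda>\<omega>. \<lambda>n\<in>J. Z' n \<omega>))"


section \<open>Hidden Markov models\<close>

text \<open>Conditional probabilities are only constrained when the conditioning event has positive
  probability. The kernel \<open>f\<close> collects the read-out distributions; that it does not depend on
  \<open>n\<close> is the time homogeneity of the read-out.\<close>

definition hidden_markov_pair ::
    "'a measure \<Rightarrow> nat \<Rightarrow> (nat \<Rightarrow> 'a \<Rightarrow> 'x::countable) \<Rightarrow> (nat \<Rightarrow> 'a \<Rightarrow> 'r::countable) \<Rightarrow> bool" where
  "hidden_markov_pair N n0 X Z \<longleftrightarrow>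
     homogeneous_markov_chain N n0 X \<and>
     discrete_process N n0 Z \<and>
     (\<forall>m\<ge>n0. \<forall>(A :: nat \<Rightarrow> 'r set) (x :: nat \<Rightarrow> 'x).
        \<P>(\<omega> in N. \<forall>n\<in>{n0..m}. X n \<omega> = x n) > 0 \<longrightarrow>
        \<P>(\<omega> in N. \<forall>n\<in>{n0..m}. Z n \<omega> \<in> A n \<bar> \<forall>n\<in>{n0..m}. X n \<omega> = x n) =
        (\<Prod>n=n0..m. \<P>(\<omega> in N. Z n \<omega> \<in> A n \<bar> X n \<omega> = x n))) \<and>
     (\<exists>f :: 'x \<Rightarrow> 'r pmf. \<forall>n\<ge>n0. \<forall>x B.
        \<P>(\<omega> in N. X n \<omega> = x) > 0 \<longrightarrow>
        \<P>(\<omega> in N. Z n \<omega> \<in> B \<bar> X n \<omega> = x) = measure_pmf.prob (f x) B)"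

text \<open>Existential quantification over types is not available, so the hidden state space is
  \<^typ>\<open>nat\<close> and the sample space of the pair is the type of its paths. Neither choice is a
  restriction: see \<open>recurrent_hidden_markov_modelI\<close> below.\<close>

definition recurrent_hidden_markov_model ::
    "'a measure \<Rightarrow> nat \<Rightarrow> (nat \<Rightarrow> 'a \<Rightarrow> 'r::countable) \<Rightarrow> bool" where
  "recurrent_hidden_markov_model M n0 Z \<longleftrightarrow>
     discrete_process M n0 Z \<and>
     (\<exists>(N :: (nat \<Rightarrow> nat \<times> 'r) measure) (X :: nat \<Rightarrow> _ \<Rightarrow> nat) Z'.
        hidden_markov_pair N n0 X Z' \<and> recurrent_chain N n0 X \<and>
        same_finite_dim_distributions n0 M Z N Z')"

lemma recurrent_hidden_markov_modelI:
  fixes M :: "'a measure" and Z :: "nat \<Rightarrow> 'a \<Rightarrow> 'r::countable"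
    and N :: "'b measure" and X :: "nat \<Rightarrow> 'b \<Rightarrow> 'x::countable" and Z' :: "nat \<Rightarrow> 'b \<Rightarrow> 'r"
  assumes Z: "discrete_process M n0 Z"
    and pair: "hidden_markov_pair N n0 X Z'"
    and rec: "recurrent_chain N n0 X"
    and fdd: "same_finite_dim_distributions n0 M Z N Z'"
  shows "recurrent_hidden_markov_model M n0 Z"
proof -
  let ?C = "Pi\<^sub>M UNIV (\<lambda>_. count_space UNIV) :: (nat \<Rightarrow> nat \<times> 'r) measure"
  define T where "T \<omega> n = (if n0 \<le> n then (to_nat (X n \<omega>), Z' n \<omega>) else undefined)" for \<omega> n
  define L where "L = distr N ?C T"
  define XX where "XX n p = fst (p n)" for n and p :: "nat \<Rightarrow> nat \<times> 'r"
  define ZZ where "ZZ n p = snd (p n)" for n and p :: "nat \<Rightarrow> nat \<times> 'r"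
  have chain: "homogeneous_markov_chain N n0 X" and Z': "discrete_process N n0 Z'"
    using pair by (auto simp: hidden_markov_pair_def)
  interpret N: prob_space N using Z' by (simp add: discrete_process_def)
  have Xm: "X n \<in> N \<rightarrow>\<^sub>M count_space UNIV" if "n0 \<le> n" for n
    using chain that by (simp add: homogeneous_markov_chain_def discrete_process_def)
  have Zm: "Z' n \<in> N \<rightarrow>\<^sub>M count_space UNIV" if "n0 \<le> n" for n
    using Z' that by (simp add: discrete_process_def)
  have T: "T \<in> N \<rightarrow>\<^sub>M ?C"
  proof (rule measurable_PiM_single')
    show "(\<lambda>\<omega>. T \<omega> n) \<in> N \<rightarrow>\<^sub>M count_space UNIV" for n
    proof (cases "n0 \<le> n")
      case True
      have "(\<lambda>\<omega>. (X n \<omega>, Z' n \<omega>)) \<in> N \<rightarrow>\<^sub>M (count_space UNIV \<Otimes>\<^sub>M count_space UNIV)"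
        using Xm[OF True] Zm[OF True] by simp
      then have *: "(\<lambda>\<omega>. (X n \<omega>, Z' n \<omega>)) \<in> N \<rightarrow>\<^sub>M count_space UNIV"
        by (simp add: pair_measure_countable)
      have "(\<lambda>p. (to_nat (fst p), snd p)) \<circ> (\<lambda>\<omega>. (X n \<omega>, Z' n \<omega>)) \<in> N \<rightarrow>\<^sub>M count_space UNIV"
        by (rule measurable_comp[OF *]) simp
      then show ?thesis using True by (simp add: T_def comp_def)
    qed (simp add: T_def)
  qed (simp add: PiE_def)
  have sp: "space L = UNIV" by (simp add: L_def space_PiM PiE_def)
  interpret L: prob_space L unfolding L_def by (rule N.prob_space_distr[OF T])
  have comp: "(\<lambda>p. p n) \<in> ?C \<rightarrow>\<^sub>M count_space UNIV" for n
    by (rule measurable_component_singleton) simp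
  have comp1: "XX n \<in> ?C \<rightarrow>\<^sub>M count_space UNIV" for n
    using measurable_comp[OF comp[of n], of fst "count_space UNIV"]
    by (simp add: XX_def[abs_def] comp_def)
  have comp2: "ZZ n \<in> ?C \<rightarrow>\<^sub>M count_space UNIV" for n
    using measurable_comp[OF comp[of n], of snd "count_space UNIV"]
    by (simp add: ZZ_def[abs_def] comp_def)
  note [measurable] = comp1 comp2
  have pr: "\<P>(p in L. P p) = \<P>(\<omega> in N. P (T \<omega>))" if "Measurable.pred ?C P" for P
  proof -
    have "{p \<in> space ?C. P p} \<in> sets ?C" using that by measurable
    then show ?thesis
      unfolding L_def by (subst measure_distr[OF T])
        (auto intro!: arg_cong[where f="measure N"] dest: measurable_space[OF T])
  qed
  have cpr: "\<P>(p in L. P p \<bar> Q p) = \<P>(\<omega> in N. P (T \<omega>) \<bar> Q (T \<omega>))"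
    if [measurable]: "Measurable.pred ?C P" "Measurable.pred ?C Q" for P Q
    unfolding cond_prob_def by (simp add: pr)
  have XT: "XX n (T \<omega>) = to_nat (X n \<omega>)" and ZT: "ZZ n (T \<omega>) = Z' n \<omega>" if "n0 \<le> n" for n \<omega>
    using that by (simp_all add: XX_def ZZ_def T_def)
  have pathX: "(\<forall>k\<in>{n0..n}. XX k (T \<omega>) = i k) \<longleftrightarrow> (\<forall>k\<in>{n0..n}. to_nat (X k \<omega>) = i k)" for n i \<omega>
    by (auto simp: XT)
  have pathZ: "(\<forall>k\<in>{n0..n}. ZZ k (T \<omega>) \<in> A k) \<longleftrightarrow> (\<forall>k\<in>{n0..n}. Z' k \<omega> \<in> A k)" for n A \<omega>
    by (auto simp: ZT)
  have decode: "\<exists>x. \<forall>k\<in>{n0..n}. i k = to_nat (x k :: 'x)"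
    if "\<P>(\<omega> in N. \<forall>k\<in>{n0..n}. to_nat (X k \<omega>) = i k) > 0" for n i
  proof -
    have "{\<omega> \<in> space N. \<forall>k\<in>{n0..n}. to_nat (X k \<omega>) = i k} \<noteq> {}"
      using that by (metis measure_empty less_irrefl)
    then obtain \<omega> where "\<forall>k\<in>{n0..n}. to_nat (X k \<omega>) = i k" by blast
    then show ?thesis by (intro exI[of _ "\<lambda>k. X k \<omega>"]) auto
  qed
  have pathx: "(\<forall>k\<in>{n0..n}. to_nat (X k \<omega>) = i k) \<longleftrightarrow> (\<forall>k\<in>{n0..n}. X k \<omega> = x k)"
    if "\<forall>k\<in>{n0..n}. i k = to_nat (x k)" for n i x \<omega>
    using that by auto
  have LX: "discrete_process L n0 XX" and LZ: "discrete_process L n0 ZZ"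
    unfolding discrete_process_def L_def
    using comp1 comp2 L.prob_space_axioms by (simp_all add: L_def)
  have "homogeneous_markov_chain L n0 XX"
  proof -
    obtain K where K: "\<And>n x x'. n0 \<le> n \<Longrightarrow> \<P>(\<omega> in N. \<forall>k\<in>{n0..n}. X k \<omega> = x k) > 0 \<Longrightarrow>
        \<P>(\<omega> in N. X (Suc n) \<omega> = x' \<bar> \<forall>k\<in>{n0..n}. X k \<omega> = x k) = pmf (K (x n)) x'"
      using chain unfolding homogeneous_markov_chain_def by blast
    have "\<P>(p in L. XX (Suc n) p = j \<bar> \<forall>k\<in>{n0..n}. XX k p = i k) =
        pmf (map_pmf to_nat (K (from_nat (i n)))) j"
      if n: "n0 \<le> n" and pos: "\<P>(p in L. \<forall>k\<in>{n0..n}. XX k p = i k) > 0" for n i j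
    proof -
      have pos': "\<P>(\<omega> in N. \<forall>k\<in>{n0..n}. to_nat (X k \<omega>) = i k) > 0"
        using pos by (subst (asm) pr) (simp_all add: pathX)
      then obtain x :: "nat \<Rightarrow> 'x" where x: "\<forall>k\<in>{n0..n}. i k = to_nat (x k)" using decode by blast
      have eq: "\<P>(p in L. XX (Suc n) p = j \<bar> \<forall>k\<in>{n0..n}. XX k p = i k) =
          \<P>(\<omega> in N. to_nat (X (Suc n) \<omega>) = j \<bar> \<forall>k\<in>{n0..n}. X k \<omega> = x k)"
        using n by (subst cpr) (simp_all add: pathX pathx[OF x] XT)
      have i: "from_nat (i n) = x n" using x n by simp
      show ?thesis
      proof (cases "j \<in> range (to_nat :: 'x \<Rightarrow> nat)")
        case True
        then obtain x' :: 'x where x': "j = to_nat x'" by blast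
        have "\<P>(\<omega> in N. X (Suc n) \<omega> = x' \<bar> \<forall>k\<in>{n0..n}. X k \<omega> = x k) = pmf (K (x n)) x'"
          using K[OF n] pos' by (simp add: pathx[OF x])
        then show ?thesis
          unfolding eq i unfolding x' by (simp add: pmf_map_inj')
      next
        case False
        then have "to_nat (X (Suc n) \<omega>) \<noteq> j" for \<omega> by auto
        moreover have "pmf (map_pmf to_nat (K (x n))) j = 0"
          using False by (auto simp: pmf_eq_0_set_pmf)
        ultimately show ?thesis
          unfolding eq i by (simp add: cond_prob_def)
      qed
    qed
    then show ?thesis
      unfolding homogeneous_markov_chain_def using LX
      by (intro conjI exI[of _ "\<lambda>i. map_pmf to_nat (K (from_nat i))"]) auto
  qed
  moreover have "\<P>(p in L. \<forall>n\<in>{n0..m}. ZZ n p \<in> A n \<bar> \<forall>n\<in>{n0..m}. XX n p = i n) =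
        (\<Prod>n=n0..m. \<P>(p in L. ZZ n p \<in> A n \<bar> XX n p = i n))"
    if m: "n0 \<le> m" and pos: "\<P>(p in L. \<forall>n\<in>{n0..m}. XX n p = i n) > 0" for m A i
  proof -
    have pos': "\<P>(\<omega> in N. \<forall>k\<in>{n0..m}. to_nat (X k \<omega>) = i k) > 0"
      using pos by (subst (asm) pr) (simp_all add: pathX)
    then obtain x :: "nat \<Rightarrow> 'x" where x: "\<forall>k\<in>{n0..m}. i k = to_nat (x k)" using decode by blast
    have "\<P>(p in L. \<forall>n\<in>{n0..m}. ZZ n p \<in> A n \<bar> \<forall>n\<in>{n0..m}. XX n p = i n) =
        \<P>(\<omega> in N. \<forall>n\<in>{n0..m}. Z' n \<omega> \<in> A n \<bar> \<forall>n\<in>{n0..m}. X n \<omega> = x n)"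
      by (subst cpr) (simp_all add: pathX pathZ pathx[OF x])
    also have "\<dots> = (\<Prod>n=n0..m. \<P>(\<omega> in N. Z' n \<omega> \<in> A n \<bar> X n \<omega> = x n))"
      using pair m pos' unfolding hidden_markov_pair_def by (simp add: pathx[OF x])
    also have "\<dots> = (\<Prod>n=n0..m. \<P>(p in L. ZZ n p \<in> A n \<bar> XX n p = i n))"
      using x by (intro prod.cong refl) (subst cpr, simp_all add: XT ZT)
    finally show ?thesis .
  qed
  moreover have "\<exists>f :: nat \<Rightarrow> 'r pmf. \<forall>n\<ge>n0. \<forall>i B. \<P>(p in L. XX n p = i) > 0 \<longrightarrow>
        \<P>(p in L. ZZ n p \<in> B \<bar> XX n p = i) = measure_pmf.prob (f i) B"
  proof -
    obtain f where f: "\<And>n x B. n0 \<le> n \<Longrightarrow> \<P>(\<omega> in N. X n \<omega> = x) > 0 \<Longrightarrow>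
        \<P>(\<omega> in N. Z' n \<omega> \<in> B \<bar> X n \<omega> = x) = measure_pmf.prob (f x) B"
      using pair unfolding hidden_markov_pair_def by blast
    have "\<P>(p in L. ZZ n p \<in> B \<bar> XX n p = i) = measure_pmf.prob (f (from_nat i)) B"
      if n: "n0 \<le> n" and pos: "\<P>(p in L. XX n p = i) > 0" for n i B
    proof -
      have pos': "\<P>(\<omega> in N. to_nat (X n \<omega>) = i) > 0"
        using pos n by (subst (asm) pr) (simp_all add: XT)
      then have "{\<omega> \<in> space N. to_nat (X n \<omega>) = i} \<noteq> {}" by (metis measure_empty less_irrefl)
      then obtain x :: 'x where x: "i = to_nat x" by blast
      show ?thesis
        using n f[OF n, of x B] pos' by (subst cpr) (simp_all add: XT ZT x)
    qed
    then show ?thesis by (intro exI[of _ "\<lambda>i. f (from_nat i)"]) auto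
  qed
  ultimately have "hidden_markov_pair L n0 XX ZZ"
    unfolding hidden_markov_pair_def using LZ by blast
  moreover have "recurrent_chain L n0 XX"
    unfolding recurrent_chain_def
  proof (intro allI impI)
    fix i assume pos: "\<P>(p in L. XX n0 p = i) > 0"
    have pos': "\<P>(\<omega> in N. to_nat (X n0 \<omega>) = i) > 0"
      using pos by (subst (asm) pr) (simp_all add: XT)
    then have "{\<omega> \<in> space N. to_nat (X n0 \<omega>) = i} \<noteq> {}" by (metis measure_empty less_irrefl)
    then obtain x :: 'x where x: "i = to_nat x" by blast
    have "{n. n0 \<le> n \<and> XX n (T \<omega>) = i} = {n. n0 \<le> n \<and> X n \<omega> = x}" for \<omega>
      by (auto simp: XT x)
    moreover have "Measurable.pred ?C (\<lambda>p. infinite {n. n0 \<le> n \<and> XX n p = i})"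
      unfolding infinite_nat_iff_unbounded_le mem_Collect_eq by measurable
    ultimately show "\<P>(p in L. infinite {n. n0 \<le> n \<and> XX n p = i} \<bar> XX n0 p = i) = 1"
      using rec pos' unfolding recurrent_chain_def
      by (subst cpr) (simp_all add: XT x)
  qed
  moreover have "same_finite_dim_distributions n0 M Z L ZZ"
    unfolding same_finite_dim_distributions_def
  proof (intro allI impI)
    fix J :: "nat set" assume J: "finite J \<and> J \<subseteq> {n0..}"
    have "distr L (Pi\<^sub>M J (\<lambda>_. count_space UNIV)) (\<lambda>p. \<lambda>n\<in>J. ZZ n p) =
        distr N (Pi\<^sub>M J (\<lambda>_. count_space UNIV)) ((\<lambda>p. \<lambda>n\<in>J. ZZ n p) \<circ> T)"
      unfolding L_def by (rule distr_distr[OF _ T]) (intro measurable_restrict comp2)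
    also have "(\<lambda>p. \<lambda>n\<in>J. ZZ n p) \<circ> T = (\<lambda>\<omega>. \<lambda>n\<in>J. Z' n \<omega>)"
      using J by (auto simp: fun_eq_iff ZT restrict_def)
    finally have L: "distr L (Pi\<^sub>M J (\<lambda>_. count_space UNIV)) (\<lambda>p. \<lambda>n\<in>J. ZZ n p) =
        distr N (Pi\<^sub>M J (\<lambda>_. count_space UNIV)) (\<lambda>\<omega>. \<lambda>n\<in>J. Z' n \<omega>)" .
    show "distr M (Pi\<^sub>M J (\<lambda>_. count_space UNIV)) (\<lambda>\<omega>. \<lambda>n\<in>J. Z n \<omega>) =
        distr L (Pi\<^sub>M J (\<lambda>_. count_space UNIV)) (\<lambda>p. \<lambda>n\<in>J. ZZ n p)"
      unfolding L using fdd J unfolding same_finite_dim_distributions_def by blast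
  qed
  ultimately show ?thesis
    unfolding recurrent_hidden_markov_model_def using Z by blast
qed


section \<open>The successors array\<close>

text \<open>\<^const>\<open>None\<close> plays the role of the extra point. The function \<^const>\<open>enumerate\<close> counts
  from 0, so the \<open>n\<close>-th visit (\<open>n \<ge> 1\<close>) has index \<open>n - 1\<close>; the value at \<open>n = 0\<close> is
  irrelevant.\<close>

definition successor :: "(nat \<Rightarrow> 's) \<Rightarrow> 's \<Rightarrow> nat \<Rightarrow> 's option" where
  "successor u y n =
     (let visits = {k. u k = y} in
      if finite visits \<and> card visits < n then None
      else Some (u (Suc (enumerate visits (n - 1)))))"

definition successors_array :: "(nat \<Rightarrow> 'a \<Rightarrow> 's) \<Rightarrow> 's \<Rightarrow> nat \<Rightarrow> 'a \<Rightarrow> 's option" where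
  "successors_array Y y n \<omega> = successor (\<lambda>k. Y k \<omega>) y n"

end

theory Submission
  imports Defs
begin

text \<open>If \<open>X\<close> is the hidden chain and \<open>Z\<close> the read-out, then \<open>W n = (X n, Z n)\<close> is a Markov chain whose
  transition probabilities depend on the current hidden state only. By the strong Markov property
  the states that \<open>W\<close> takes immediately after its successive visits to \<open>{w. snd w = y}\<close>, with an
  absorbing extra state if there are no more visits, form a Markov chain; the row of the successors
  array is a function of it.

  For recurrence: a step whose probability is bounded below on a set that is visited infinitely
  often is itself made infinitely often, and every step actually made has positive probability.
  Starting from the infinitely many returns of \<open>X\<close> to its initial state, this shows that almost
  surely every step of \<open>W\<close> is repeated infinitely often, in particular the step out of the first
  visit.\<close>

section \<open>Countable decompositions of events\<close>

context prob_space
begin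

lemma prob_Ex_disjoint:
  fixes A :: "'i::countable \<Rightarrow> 'a \<Rightarrow> bool"
  assumes "\<And>i. Measurable.pred M (A i)" and "\<And>i j \<omega>. A i \<omega> \<Longrightarrow> A j \<omega> \<Longrightarrow> i = j"
  shows "ennreal \<P>(\<omega> in M. \<exists>i. A i \<omega>) = (\<integral>\<^sup>+i. ennreal \<P>(\<omega> in M. A i \<omega>) \<partial>count_space UNIV)"
  using prob_EX_countable[of UNIV A] assms by (simp add: pred_def)

lemma prob_Ex_disjoint_eq_mult:
  fixes A B :: "'i::countable \<Rightarrow> 'a \<Rightarrow> bool"
  assumes meas: "\<And>i. Measurable.pred M (A i)" "\<And>i. Measurable.pred M (B i)"
    and sub: "\<And>i \<omega>. A i \<omega> \<Longrightarrow> B i \<omega>" and disj: "\<And>i j \<omega>. B i \<omega> \<Longrightarrow> B j \<omega> \<Longrightarrow> i = j"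
    and "0 \<le> q" and eq: "\<And>i. \<P>(\<omega> in M. A i \<omega>) = \<P>(\<omega> in M. B i \<omega>) * q"
  shows "\<P>(\<omega> in M. \<exists>i. A i \<omega>) = \<P>(\<omega> in M. \<exists>i. B i \<omega>) * q"
proof -
  have "ennreal \<P>(\<omega> in M. \<exists>i. A i \<omega>) = (\<integral>\<^sup>+i. ennreal \<P>(\<omega> in M. A i \<omega>) \<partial>count_space UNIV)"
    using meas(1) sub disj by (intro prob_Ex_disjoint) blast+
  also have "\<dots> = ennreal \<P>(\<omega> in M. \<exists>i. B i \<omega>) * ennreal q"
    by (simp add: eq ennreal_mult'' \<open>0 \<le> q\<close> nn_integral_multc prob_Ex_disjoint[of B, OF meas(2) disj])
  finally show ?thesis
    using \<open>0 \<le> q\<close> by (simp flip: ennreal_mult)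
qed

lemma prob_Ex_disjoint_le_mult:
  fixes A B :: "'i::countable \<Rightarrow> 'a \<Rightarrow> bool"
  assumes meas: "\<And>i. Measurable.pred M (A i)" "\<And>i. Measurable.pred M (B i)"
    and sub: "\<And>i \<omega>. A i \<omega> \<Longrightarrow> B i \<omega>" and disj: "\<And>i j \<omega>. B i \<omega> \<Longrightarrow> B j \<omega> \<Longrightarrow> i = j"
    and "0 \<le> q" and le: "\<And>i. \<P>(\<omega> in M. A i \<omega>) \<le> \<P>(\<omega> in M. B i \<omega>) * q"
  shows "\<P>(\<omega> in M. \<exists>i. A i \<omega>) \<le> \<P>(\<omega> in M. \<exists>i. B i \<omega>) * q"
proof -
  have "ennreal \<P>(\<omega> in M. \<exists>i. A i \<omega>) = (\<integral>\<^sup>+i. ennreal \<P>(\<omega> in M. A i \<omega>) \<partial>count_space UNIV)"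
    using meas(1) sub disj by (intro prob_Ex_disjoint) blast+
  also have "\<dots> \<le> (\<integral>\<^sup>+i. ennreal \<P>(\<omega> in M. B i \<omega>) * ennreal q \<partial>count_space UNIV)"
    using le by (intro nn_integral_mono) (simp add: \<open>0 \<le> q\<close> flip: ennreal_mult)
  also have "\<dots> = ennreal \<P>(\<omega> in M. \<exists>i. B i \<omega>) * ennreal q"
    by (simp add: nn_integral_multc prob_Ex_disjoint[of B, OF meas(2) disj])
  finally show ?thesis
    using \<open>0 \<le> q\<close> by (simp flip: ennreal_mult)
qed

lemma prob_split:
  assumes "Measurable.pred M P" "Measurable.pred M Q"
  shows "\<P>(\<omega> in M. P \<omega>) = \<P>(\<omega> in M. P \<omega> \<and> Q \<omega>) + \<P>(\<omega> in M. P \<omega> \<and> \<not> Q \<omega>)"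
  using assms by (subst finite_measure_Union[symmetric]) (auto intro!: arg_cong[where f=prob])

lemma prob_conj_eq_mult:
  assumes [measurable]: "Measurable.pred M Q"
    and cond: "\<P>(\<omega> in M. Q \<omega>) > 0 \<Longrightarrow> \<P>(\<omega> in M. P \<omega> \<bar> Q \<omega>) = q"
  shows "\<P>(\<omega> in M. P \<omega> \<and> Q \<omega>) = \<P>(\<omega> in M. Q \<omega>) * q"
proof (cases "\<P>(\<omega> in M. Q \<omega>) = 0")
  case True
  have "\<P>(\<omega> in M. P \<omega> \<and> Q \<omega>) \<le> \<P>(\<omega> in M. Q \<omega>)"
    by (rule finite_measure_mono) auto
  with True show ?thesis by (simp add: measure_le_0_iff)
next
  case False
  then show ?thesis
    using cond by (simp add: zero_less_measure_iff cond_prob_def nonzero_divide_eq_eq mult.commute)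
qed

lemma AE_discreteI:
  fixes X :: "'a \<Rightarrow> 'x::countable"
  assumes [measurable]: "X \<in> M \<rightarrow>\<^sub>M count_space UNIV" and "\<And>x. \<P>(\<omega> in M. X \<omega> = x) > 0 \<Longrightarrow> P x"
  shows "AE \<omega> in M. P (X \<omega>)"
proof -
  have "AE \<omega> in M. X \<omega> \<noteq> x" if "\<not> P x" for x
    using assms(2)[of x] that by (subst prob_Collect_eq_0[symmetric]) (auto simp: zero_less_measure_iff)
  then have "AE \<omega> in M. \<forall>x. \<not> P x \<longrightarrow> X \<omega> \<noteq> x"
    by (simp add: AE_all_countable)
  then show ?thesis by eventually_elim blast
qed

lemma cond_prob_const:
  assumes "\<P>(\<omega> in M. Q \<omega>) > 0" and "\<And>\<omega>. Q \<omega> \<Longrightarrow> P \<omega> \<longleftrightarrow> c"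
  shows "\<P>(\<omega> in M. P \<omega> \<bar> Q \<omega>) = of_bool c"
proof -
  have "P \<omega> \<and> Q \<omega> \<longleftrightarrow> c \<and> Q \<omega>" for \<omega>
    using assms(2) by blast
  then show ?thesis
    using assms(1) by (simp add: cond_prob_def)
qed

lemma cond_prob_eq_1_iff_AE:
  assumes [measurable]: "Measurable.pred M P" "Measurable.pred M Q"
  shows "(\<P>(\<omega> in M. Q \<omega>) > 0 \<longrightarrow> \<P>(\<omega> in M. P \<omega> \<bar> Q \<omega>) = 1) \<longleftrightarrow> (AE \<omega> in M. Q \<omega> \<longrightarrow> P \<omega>)"
proof -
  have "\<P>(\<omega> in M. Q \<omega>) = \<P>(\<omega> in M. P \<omega> \<and> Q \<omega>) + \<P>(\<omega> in M. \<not> (Q \<omega> \<longrightarrow> P \<omega>))"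
    using prob_split[of Q P] by (simp add: conj_commute)
  then have "(\<P>(\<omega> in M. Q \<omega>) > 0 \<longrightarrow> \<P>(\<omega> in M. P \<omega> \<bar> Q \<omega>) = 1) \<longleftrightarrow>
      \<P>(\<omega> in M. \<not> (Q \<omega> \<longrightarrow> P \<omega>)) = 0"
    by (auto simp: cond_prob_def less_le measure_nonneg add_nonneg_eq_0_iff simp del: not_imp)
  also have "\<dots> \<longleftrightarrow> (AE \<omega> in M. Q \<omega> \<longrightarrow> P \<omega>)"
    by (subst prob_Collect_eq_0) auto
  finally show ?thesis .
qed

end

lemma measurable_Pair_count_space:
  fixes f :: "'a \<Rightarrow> 'b::countable" and g :: "'a \<Rightarrow> 'c::countable"
  assumes [measurable]: "f \<in> M \<rightarrow>\<^sub>M count_space UNIV" "g \<in> M \<rightarrow>\<^sub>M count_space UNIV"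
  shows "(\<lambda>\<omega>. (f \<omega>, g \<omega>)) \<in> M \<rightarrow>\<^sub>M count_space UNIV"
proof -
  have "(\<lambda>\<omega>. (f \<omega>, g \<omega>)) \<in> M \<rightarrow>\<^sub>M count_space UNIV \<Otimes>\<^sub>M count_space UNIV"
    by measurable
  then show ?thesis by (simp add: pair_measure_countable)
qed

section \<open>Path space\<close>

abbreviation path_space :: "(nat \<Rightarrow> 'w::countable) measure" where
  "path_space \<equiv> Pi\<^sub>M UNIV (\<lambda>_. count_space UNIV)"

lemma space_path_space [simp]: "space path_space = UNIV"
  by (simp add: space_PiM)

lemma Collect_in_sets_path_space: "Measurable.pred path_space H \<Longrightarrow> {u. H u} \<in> sets path_space"
  by (simp add: pred_def)

definition prefix_determined :: "nat \<Rightarrow> ((nat \<Rightarrow> 'w) \<Rightarrow> bool) \<Rightarrow> bool" where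
  "prefix_determined n H \<longleftrightarrow> (\<forall>u v. (\<forall>k\<le>n. u k = v k) \<longrightarrow> H u = H v)"

lemma prefix_determinedD:
  "prefix_determined n H \<Longrightarrow> (\<And>k. k \<le> n \<Longrightarrow> u k = v k) \<Longrightarrow> H u \<longleftrightarrow> H v"
  by (auto simp: prefix_determined_def)

lemma prefix_determined_mono: "prefix_determined m H \<Longrightarrow> m \<le> n \<Longrightarrow> prefix_determined n H"
  by (force simp: prefix_determined_def)

lemma prefix_determined_conj:
  "prefix_determined n H \<Longrightarrow> prefix_determined n H' \<Longrightarrow> prefix_determined n (\<lambda>u. H u \<and> H' u)"
  by (auto simp: prefix_determined_def)

definition prefix_word :: "nat \<Rightarrow> 'w list \<Rightarrow> (nat \<Rightarrow> 'w) \<Rightarrow> bool" where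
  "prefix_word n xs u \<longleftrightarrow> length xs = Suc n \<and> (\<forall>k\<le>n. u k = xs ! k)"

lemma prefix_word_unique: "prefix_word n xs u \<Longrightarrow> prefix_word n ys u \<Longrightarrow> xs = ys"
  by (intro nth_equalityI) (auto simp: prefix_word_def less_Suc_eq_le)

lemma prefix_word_measurable [measurable]: "Measurable.pred path_space (prefix_word n xs)"
  unfolding prefix_word_def by measurable

lemma prefix_determined_iff_Ex_word:
  assumes "prefix_determined n H"
  shows "H u \<longleftrightarrow> (\<exists>xs. prefix_word n xs u \<and> H (\<lambda>k. xs ! k))"
proof
  let ?xs = "map u [0..<Suc n]"
  assume "H u"
  then have "H (\<lambda>k. ?xs ! k)"
    using prefix_determinedD[OF assms, of u "\<lambda>k. ?xs ! k"] by (simp del: upt_Suc)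
  moreover have "prefix_word n ?xs u"
    by (simp add: prefix_word_def del: upt_Suc)
  ultimately show "\<exists>xs. prefix_word n xs u \<and> H (\<lambda>k. xs ! k)"
    by blast
next
  assume "\<exists>xs. prefix_word n xs u \<and> H (\<lambda>k. xs ! k)"
  then show "H u"
    using prefix_determinedD[OF assms, of u] unfolding prefix_word_def by blast
qed

lemma prefix_determined_measurable:
  fixes H :: "(nat \<Rightarrow> 'w::countable) \<Rightarrow> bool"
  assumes "prefix_determined n H"
  shows "Measurable.pred path_space H"
proof -
  have "Measurable.pred path_space (\<lambda>u. \<exists>xs. prefix_word n xs u \<and> H (\<lambda>k. xs ! k))"
    by measurable
  then show ?thesis
    by (simp only: prefix_determined_iff_Ex_word[OF assms, symmetric])
qed

lemma path_measure_eqI: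
  fixes L L' :: "(nat \<Rightarrow> 'w::countable) measure"
  assumes "prob_space L" "prob_space L'" and sets: "sets L = sets path_space" "sets L' = sets path_space"
    and cylinder: "\<And>n v. measure L {u. \<forall>k\<le>n. u k = v k} = measure L' {u. \<forall>k\<le>n. u k = v k}"
  shows "L = L'"
proof -
  interpret L: prob_space L by fact
  interpret L': prob_space L' by fact
  note [measurable_cong] = sets
  have space: "space L = UNIV" "space L' = UNIV"
    using sets[THEN sets_eq_imp_space_eq] by simp_all
  have prefix: "L.prob {u. H u} = L'.prob {u. H u}" if H: "prefix_determined n H" for n H
  proof -
    let ?C = "\<lambda>xs u. prefix_word n xs u \<and> H (\<lambda>k. xs ! k)"
    have eq: "L.prob {u. ?C xs u} = L'.prob {u. ?C xs u}" for xs
      using cylinder[of n "\<lambda>k. xs ! k"]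
      by (cases "length xs = Suc n \<and> H (\<lambda>k. xs ! k)") (auto simp: prefix_word_def)
    have "ennreal (L.prob {u. \<exists>xs. ?C xs u}) =
        (\<integral>\<^sup>+xs. ennreal (L.prob {u. ?C xs u}) \<partial>count_space UNIV)"
      by (rule L.prob_Ex_disjoint[of ?C, unfolded space, simplified])
        (measurable, blast intro: prefix_word_unique)
    moreover have "ennreal (L'.prob {u. \<exists>xs. ?C xs u}) =
        (\<integral>\<^sup>+xs. ennreal (L'.prob {u. ?C xs u}) \<partial>count_space UNIV)"
      by (rule L'.prob_Ex_disjoint[of ?C, unfolded space, simplified])
        (measurable, blast intro: prefix_word_unique)
    ultimately have "ennreal (L.prob {u. H u}) = ennreal (L'.prob {u. H u})"
      by (simp only: eq prefix_determined_iff_Ex_word[OF H, symmetric])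
    then show ?thesis by simp
  qed
  show ?thesis
  proof (rule measure_eqI_PiM_infinite[OF sets _ L.finite_measure_axioms])
    fix A :: "nat \<Rightarrow> 'w set" and J :: "nat set" assume "finite J"
    then obtain n where n: "\<forall>j\<in>J. j \<le> n" by (meson finite_nat_set_iff_bounded_le)
    have "prod_emb UNIV (\<lambda>_. count_space UNIV) J (Pi\<^sub>E J A) = {u. \<forall>j\<in>J. u j \<in> A j}"
      by (auto simp: prod_emb_def)
    moreover have "prefix_determined n (\<lambda>u. \<forall>j\<in>J. u j \<in> A j)"
      using n by (auto simp: prefix_determined_def)
    ultimately show "emeasure L (prod_emb UNIV (\<lambda>_. count_space UNIV) J (Pi\<^sub>E J A)) =
        emeasure L' (prod_emb UNIV (\<lambda>_. count_space UNIV) J (Pi\<^sub>E J A))"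
      using prefix by (simp add: L.emeasure_eq_measure L'.emeasure_eq_measure)
  qed
qed

section \<open>Markov processes\<close>

locale markov_process = prob_space M for M :: "'a measure" +
  fixes X :: "nat \<Rightarrow> 'a \<Rightarrow> 'w::countable" and p :: "'w \<Rightarrow> 'w \<Rightarrow> real"
  assumes measurable_state [measurable]: "X n \<in> M \<rightarrow>\<^sub>M count_space UNIV"
    and transition_nonneg: "0 \<le> p w w'"
    and prob_prefix_Suc: "\<P>(\<omega> in M. \<forall>k\<le>Suc n. X k \<omega> = x k) =
      \<P>(\<omega> in M. \<forall>k\<le>n. X k \<omega> = x k) * p (x n) (x (Suc n))"
begin

abbreviation trajectory :: "'a \<Rightarrow> nat \<Rightarrow> 'w" where
  "trajectory \<omega> \<equiv> (\<lambda>k. X k \<omega>)"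

abbreviation future :: "nat \<Rightarrow> 'a \<Rightarrow> nat \<Rightarrow> 'w" where
  "future n \<omega> \<equiv> (\<lambda>k. X (n + k) \<omega>)"

lemma trajectory_measurable [measurable]: "trajectory \<in> M \<rightarrow>\<^sub>M path_space"
  by (rule measurable_abs_UNIV) measurable

lemma future_measurable [measurable]: "future n \<in> M \<rightarrow>\<^sub>M path_space"
  by (rule measurable_abs_UNIV) measurable

lemma prob_step:
  assumes H: "prefix_determined n H"
  shows "\<P>(\<omega> in M. H (trajectory \<omega>) \<and> X n \<omega> = x \<and> X (Suc n) \<omega> = x') =
    \<P>(\<omega> in M. H (trajectory \<omega>) \<and> X n \<omega> = x) * p x x'"
proof -
  let ?B = "\<lambda>xs \<omega>. prefix_word n xs (trajectory \<omega>) \<and> H (\<lambda>k. xs ! k) \<and> xs ! n = x"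
  let ?A = "\<lambda>xs \<omega>. ?B xs \<omega> \<and> X (Suc n) \<omega> = x'"
  have H_iff: "H (trajectory \<omega>) \<and> X n \<omega> = x \<longleftrightarrow> (\<exists>xs. ?B xs \<omega>)" for \<omega>
    by (subst prefix_determined_iff_Ex_word[OF H, of "trajectory \<omega>"]) (auto simp: prefix_word_def)
  have word: "\<P>(\<omega> in M. ?A xs \<omega>) = \<P>(\<omega> in M. ?B xs \<omega>) * p x x'" for xs
  proof (cases "length xs = Suc n \<and> H (\<lambda>k. xs ! k) \<and> xs ! n = x")
    case True
    let ?x = "\<lambda>k. if k = Suc n then x' else xs ! k"
    have "?A xs \<omega> \<longleftrightarrow> (\<forall>k\<le>Suc n. X k \<omega> = ?x k)" "?B xs \<omega> \<longleftrightarrow> (\<forall>k\<le>n. X k \<omega> = ?x k)" for \<omega>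
      using True by (auto simp: prefix_word_def le_Suc_eq)
    then show ?thesis
      using prob_prefix_Suc[of n ?x] True by (simp only: if_True if_False simp_thms n_not_Suc_n)
  next
    case False
    then have "\<not> ?B xs \<omega>" for \<omega>
      by (auto simp: prefix_word_def)
    then show ?thesis by (simp only: simp_thms) simp
  qed
  have "\<P>(\<omega> in M. \<exists>xs. ?A xs \<omega>) = \<P>(\<omega> in M. \<exists>xs. ?B xs \<omega>) * p x x'"
  proof (rule prob_Ex_disjoint_eq_mult[OF _ _ _ _ transition_nonneg word])
    show "xs = ys" if "?B xs \<omega>" "?B ys \<omega>" for xs ys \<omega>
      using that prefix_word_unique by blast
    show "Measurable.pred M (?A xs)" "Measurable.pred M (?B xs)" for xs
      by measurable
  qed blast
  moreover have "(\<exists>xs. ?A xs \<omega>) \<longleftrightarrow> H (trajectory \<omega>) \<and> X n \<omega> = x \<and> X (Suc n) \<omega> = x'" for \<omega>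
    using H_iff[of \<omega>] by blast
  ultimately show ?thesis
    by (simp only: flip: H_iff)
qed

lemma prob_word:
  assumes H: "prefix_determined n H"
  shows "\<P>(\<omega> in M. H (trajectory \<omega>) \<and> (\<forall>k\<le>j. X (n + k) \<omega> = v k)) =
    \<P>(\<omega> in M. H (trajectory \<omega>) \<and> X n \<omega> = v 0) * (\<Prod>k<j. p (v k) (v (Suc k)))"
proof (induction j)
  case (Suc j)
  have "prefix_determined (n + j) (\<lambda>u. H u \<and> (\<forall>k\<le>j. u (n + k) = v k))"
    by (intro prefix_determined_conj prefix_determined_mono[OF H]) (auto simp: prefix_determined_def)
  from prob_step[OF this, of "v j" "v (Suc j)"]
  moreover have "(H (trajectory \<omega>) \<and> (\<forall>k\<le>j. X (n + k) \<omega> = v k)) \<and> X (n + j) \<omega> = v j \<longleftrightarrow>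
      H (trajectory \<omega>) \<and> (\<forall>k\<le>j. X (n + k) \<omega> = v k)"
    "(H (trajectory \<omega>) \<and> (\<forall>k\<le>j. X (n + k) \<omega> = v k)) \<and> X (n + j) \<omega> = v j \<and>
        X (Suc (n + j)) \<omega> = v (Suc j) \<longleftrightarrow>
      H (trajectory \<omega>) \<and> (\<forall>k\<le>Suc j. X (n + k) \<omega> = v k)" for \<omega>
    by (auto simp: le_Suc_eq)
  ultimately have "\<P>(\<omega> in M. H (trajectory \<omega>) \<and> (\<forall>k\<le>Suc j. X (n + k) \<omega> = v k)) =
      \<P>(\<omega> in M. H (trajectory \<omega>) \<and> (\<forall>k\<le>j. X (n + k) \<omega> = v k)) * p (v j) (v (Suc j))"
    by (simp only:)
  then show ?case using Suc by simp
qed simp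

definition future_law :: "nat \<Rightarrow> ('a \<Rightarrow> bool) \<Rightarrow> (nat \<Rightarrow> 'w) measure" where
  "future_law n Q = distr (uniform_measure M {\<omega> \<in> space M. Q \<omega>}) path_space (future n)"

lemma measure_future_law:
  assumes [measurable]: "Measurable.pred M Q" "Measurable.pred path_space P"
  shows "measure (future_law n Q) {u. P u} = \<P>(\<omega> in M. P (future n \<omega>) \<bar> Q \<omega>)"
proof -
  have "measure (future_law n Q) {u. P u} =
      \<P>(\<omega> in uniform_measure M {\<omega> \<in> space M. Q \<omega>}. P (future n \<omega>))"
    unfolding future_law_def
    by (subst measure_distr)
      (auto simp: Collect_in_sets_path_space intro!: arg_cong[where f="measure _"])
  also have "\<dots> = \<P>(\<omega> in M. P (future n \<omega>) \<bar> Q \<omega>)"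
    by (rule measure_uniform_measure_eq_cond_prob) measurable
  finally show ?thesis .
qed

lemma prob_space_future_law:
  assumes "Measurable.pred M Q" and "\<P>(\<omega> in M. Q \<omega>) > 0"
  shows "prob_space (future_law n Q)"
  unfolding future_law_def using assms
  by (intro prob_space.prob_space_distr prob_space_uniform_measure) (auto simp: emeasure_eq_measure)

lemma future_law_cylinder:
  assumes H: "prefix_determined n H" and pos: "\<P>(\<omega> in M. H (trajectory \<omega>) \<and> X n \<omega> = w) > 0"
  shows "measure (future_law n (\<lambda>\<omega>. H (trajectory \<omega>) \<and> X n \<omega> = w)) {u. \<forall>k\<le>j. u k = v k} =
    (if v 0 = w then \<Prod>k<j. p (v k) (v (Suc k)) else 0)"
proof -
  note [measurable] = prefix_determined_measurable[OF H]
  have "measure (future_law n (\<lambda>\<omega>. H (trajectory \<omega>) \<and> X n \<omega> = w)) {u. \<forall>k\<le>j. u k = v k} =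
      \<P>(\<omega> in M. \<forall>k\<le>j. X (n + k) \<omega> = v k \<bar> H (trajectory \<omega>) \<and> X n \<omega> = w)"
    by (rule measure_future_law) measurable
  also have "\<dots> = (if v 0 = w then \<Prod>k<j. p (v k) (v (Suc k)) else 0)"
  proof (cases "v 0 = w")
    case True
    then have "(\<forall>k\<le>j. X (n + k) \<omega> = v k) \<and> H (trajectory \<omega>) \<and> X n \<omega> = w \<longleftrightarrow>
        H (trajectory \<omega>) \<and> (\<forall>k\<le>j. X (n + k) \<omega> = v k)" for \<omega>
      by auto
    then show ?thesis
      using prob_word[OF H, of j v] pos True by (simp add: cond_prob_def)
  next
    case False
    then have "\<not> ((\<forall>k\<le>j. X (n + k) \<omega> = v k) \<and> H (trajectory \<omega>) \<and> X n \<omega> = w)" for \<omega>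
      by auto
    then show ?thesis
      using False by (simp only: cond_prob_def) simp
  qed
  finally show ?thesis .
qed

lemma future_law_unique:
  assumes H: "prefix_determined n H" "\<P>(\<omega> in M. H (trajectory \<omega>) \<and> X n \<omega> = w) > 0"
    and H': "prefix_determined n' H'" "\<P>(\<omega> in M. H' (trajectory \<omega>) \<and> X n' \<omega> = w) > 0"
  shows "future_law n (\<lambda>\<omega>. H (trajectory \<omega>) \<and> X n \<omega> = w) =
    future_law n' (\<lambda>\<omega>. H' (trajectory \<omega>) \<and> X n' \<omega> = w)"
proof (rule path_measure_eqI)
  note [measurable] = H(1)[THEN prefix_determined_measurable] H'(1)[THEN prefix_determined_measurable]
  show "prob_space (future_law n (\<lambda>\<omega>. H (trajectory \<omega>) \<and> X n \<omega> = w))"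
    "prob_space (future_law n' (\<lambda>\<omega>. H' (trajectory \<omega>) \<and> X n' \<omega> = w))"
    using H(2) H'(2) by (auto intro: prob_space_future_law)
qed (simp_all only: future_law_cylinder[OF H] future_law_cylinder[OF H'], simp_all add: future_law_def)

text \<open>The choice of the time is immaterial by \<open>future_law_unique\<close>. If \<open>w\<close> is never reached with positive
  probability, the value is arbitrary and only enters with weight 0.\<close>

definition law_from :: "'w \<Rightarrow> (nat \<Rightarrow> 'w) measure" where
  "law_from w = (let n = SOME n. \<P>(\<omega> in M. X n \<omega> = w) > 0 in future_law n (\<lambda>\<omega>. X n \<omega> = w))"

lemma markov_property:
  assumes H: "prefix_determined n H" and [measurable]: "Measurable.pred path_space P"
  shows "\<P>(\<omega> in M. (H (trajectory \<omega>) \<and> X n \<omega> = w) \<and> P (future n \<omega>)) =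
    \<P>(\<omega> in M. H (trajectory \<omega>) \<and> X n \<omega> = w) * measure (law_from w) {u. P u}"
proof -
  note [measurable] = prefix_determined_measurable[OF H]
  let ?Q = "\<lambda>\<omega>. H (trajectory \<omega>) \<and> X n \<omega> = w"
  have "\<P>(\<omega> in M. P (future n \<omega>) \<bar> ?Q \<omega>) = measure (law_from w) {u. P u}"
    if pos: "\<P>(\<omega> in M. ?Q \<omega>) > 0"
  proof -
    define m where "m = (SOME m. \<P>(\<omega> in M. X m \<omega> = w) > 0)"
    have "\<P>(\<omega> in M. ?Q \<omega>) \<le> \<P>(\<omega> in M. X n \<omega> = w)"
      by (rule finite_measure_mono, blast, measurable)
    with pos have "\<P>(\<omega> in M. X n \<omega> = w) > 0"
      by (rule less_le_trans)
    then have "\<P>(\<omega> in M. X m \<omega> = w) > 0"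
      unfolding m_def by (rule someI)
    then have "law_from w = future_law n ?Q"
      using future_law_unique[OF H pos, of m "\<lambda>_. True"]
      by (simp add: law_from_def Let_def m_def prefix_determined_def)
    then show ?thesis
      by (simp add: measure_future_law)
  qed
  then have "\<P>(\<omega> in M. P (future n \<omega>) \<and> ?Q \<omega>) = \<P>(\<omega> in M. ?Q \<omega>) * measure (law_from w) {u. P u}"
    by (intro prob_conj_eq_mult) measurable
  then show ?thesis
    by (simp only: conj_commute)
qed

lemma strong_markov_property:
  fixes H :: "'i::countable \<Rightarrow> (nat \<Rightarrow> 'w) \<Rightarrow> bool"
  assumes H: "\<And>i. prefix_determined (t i) (H i)" and disj: "\<And>i j u. H i u \<Longrightarrow> H j u \<Longrightarrow> i = j"
    and [measurable]: "Measurable.pred path_space P"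
  shows "\<P>(\<omega> in M. \<exists>i. (H i (trajectory \<omega>) \<and> X (t i) \<omega> = w) \<and> P (future (t i) \<omega>)) =
    \<P>(\<omega> in M. \<exists>i. H i (trajectory \<omega>) \<and> X (t i) \<omega> = w) * measure (law_from w) {u. P u}"
proof (rule prob_Ex_disjoint_eq_mult)
  note [measurable] = prefix_determined_measurable[OF H]
  show "Measurable.pred M (\<lambda>\<omega>. (H i (trajectory \<omega>) \<and> X (t i) \<omega> = w) \<and> P (future (t i) \<omega>))"
    "Measurable.pred M (\<lambda>\<omega>. H i (trajectory \<omega>) \<and> X (t i) \<omega> = w)" for i
    by measurable
qed (use markov_property[OF H] disj in auto)

end

section \<open>Recurrence along almost every path\<close>

lemma infinite_Collect_SucD:
  assumes "infinite {n. Q n \<and> P (Suc n)}"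
  shows "infinite {n. P n}"
proof -
  have "infinite (Suc ` {n. Q n \<and> P (Suc n)})"
    using assms by (simp add: finite_image_iff)
  then show ?thesis
    by (rule infinite_super[rotated]) auto
qed

definition always_misses :: "'w set \<Rightarrow> 'w \<Rightarrow> nat \<Rightarrow> (nat \<Rightarrow> 'w) \<Rightarrow> bool" where
  "always_misses G b n u \<longleftrightarrow> infinite {k. u k \<in> G} \<and> (\<forall>k\<ge>n. u k \<in> G \<longrightarrow> u (Suc k) \<noteq> b)"

definition first_entry :: "'w set \<Rightarrow> nat \<Rightarrow> nat \<Rightarrow> (nat \<Rightarrow> 'w) \<Rightarrow> bool" where
  "first_entry G n m u \<longleftrightarrow> n \<le> m \<and> u m \<in> G \<and> (\<forall>k\<in>{n..<m}. u k \<notin> G)"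

lemma first_entry_unique: "first_entry G n m u \<Longrightarrow> first_entry G n m' u \<Longrightarrow> m = m'"
  by (rule linorder_cases[of m m']) (auto simp: first_entry_def)

lemma Ex_first_entry:
  assumes "infinite {k. u k \<in> G}"
  shows "\<exists>m. first_entry G n m u"
proof -
  have ex: "\<exists>m. n \<le> m \<and> u m \<in> G"
    using assms by (auto simp: infinite_nat_iff_unbounded_le)
  have "first_entry G n (LEAST m. n \<le> m \<and> u m \<in> G) u"
    using LeastI_ex[OF ex] by (auto simp: first_entry_def dest: not_less_Least)
  then show ?thesis ..
qed

lemma always_misses_restart:
  assumes "always_misses G b n u"
  obtains m where "first_entry G n m u" "u (Suc m) \<noteq> b" "always_misses G b (Suc m) u"
proof -
  obtain m where "first_entry G n m u"
    using Ex_first_entry assms unfolding always_misses_def by blast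
  then show thesis
    using assms that[of m] by (auto simp: always_misses_def first_entry_def)
qed

lemma always_misses_measurable [measurable]:
  "Measurable.pred path_space (always_misses G b n :: (nat \<Rightarrow> 'w::countable) \<Rightarrow> bool)"
  unfolding always_misses_def infinite_nat_iff_unbounded_le mem_Collect_eq by measurable

lemma prefix_determined_conj_first_entry:
  assumes "prefix_determined n H"
  shows "prefix_determined m (\<lambda>u. H u \<and> first_entry G n m u)"
proof (cases "n \<le> m")
  case True
  show ?thesis
    by (intro prefix_determined_conj prefix_determined_mono[OF assms True])
      (auto simp: prefix_determined_def first_entry_def)
qed (simp add: prefix_determined_def first_entry_def)

context markov_process
begin

lemma prob_step_avoids_le:
  assumes H: "prefix_determined n H" and G: "\<And>u. H u \<Longrightarrow> u n \<in> G"
    and \<delta>: "\<And>x. x \<in> G \<Longrightarrow> \<delta> \<le> p x b" "\<delta> \<le> 1"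
  shows "\<P>(\<omega> in M. H (trajectory \<omega>) \<and> X (Suc n) \<omega> \<noteq> b) \<le> \<P>(\<omega> in M. H (trajectory \<omega>)) * (1 - \<delta>)"
proof -
  note [measurable] = prefix_determined_measurable[OF H]
  let ?B = "\<lambda>x \<omega>. H (trajectory \<omega>) \<and> X n \<omega> = x"
  have "\<P>(\<omega> in M. ?B x \<omega> \<and> X (Suc n) \<omega> \<noteq> b) \<le> \<P>(\<omega> in M. ?B x \<omega>) * (1 - \<delta>)" for x
  proof (cases "x \<in> G")
    case True
    have "\<P>(\<omega> in M. ?B x \<omega>) = \<P>(\<omega> in M. ?B x \<omega>) * p x b + \<P>(\<omega> in M. ?B x \<omega> \<and> X (Suc n) \<omega> \<noteq> b)"
      using prob_split[of "?B x" "\<lambda>\<omega>. X (Suc n) \<omega> = b"] prob_step[OF H, of x b] by simp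
    moreover have "\<P>(\<omega> in M. ?B x \<omega>) * \<delta> \<le> \<P>(\<omega> in M. ?B x \<omega>) * p x b"
      using \<delta>(1)[OF True] by (intro mult_left_mono) auto
    ultimately show ?thesis by (simp add: algebra_simps)
  next
    case False
    then have "\<not> ?B x \<omega>" for \<omega> using G by blast
    then show ?thesis by (simp only: simp_thms) simp
  qed
  then have "\<P>(\<omega> in M. \<exists>x. ?B x \<omega> \<and> X (Suc n) \<omega> \<noteq> b) \<le> \<P>(\<omega> in M. \<exists>x. ?B x \<omega>) * (1 - \<delta>)"
    using \<delta>(2) by (intro prob_Ex_disjoint_le_mult) auto
  then show ?thesis by simp
qed

text \<open>Decompose by the first visit to \<open>G\<close> from time \<open>n\<close> on: the step after it avoids \<open>b\<close> with conditional
  probability at most \<open>1 - \<delta>\<close>, and then the process is restarted.\<close>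

lemma prob_always_misses_restart_le:
  assumes H: "prefix_determined n H" and \<delta>: "\<And>x. x \<in> G \<Longrightarrow> \<delta> \<le> p x b" "\<delta> \<le> 1" and "0 \<le> q"
    and later: "\<And>m H'. prefix_determined m H' \<Longrightarrow>
      \<P>(\<omega> in M. H' (trajectory \<omega>) \<and> always_misses G b m (trajectory \<omega>)) \<le>
      \<P>(\<omega> in M. H' (trajectory \<omega>)) * q"
  shows "\<P>(\<omega> in M. H (trajectory \<omega>) \<and> always_misses G b n (trajectory \<omega>)) \<le>
    \<P>(\<omega> in M. H (trajectory \<omega>)) * ((1 - \<delta>) * q)"
proof -
  let ?F = "\<lambda>m u. H u \<and> first_entry G n m u"
  let ?miss = "\<lambda>m u. ?F m u \<and> u (Suc m) \<noteq> b"
  let ?A = "\<lambda>m \<omega>. ?miss m (trajectory \<omega>) \<and> always_misses G b (Suc m) (trajectory \<omega>)"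
  have F: "prefix_determined m (?F m)" for m
    using H by (rule prefix_determined_conj_first_entry)
  have miss: "prefix_determined (Suc m) (?miss m)" for m
    by (intro prefix_determined_conj prefix_determined_mono[OF F]) (auto simp: prefix_determined_def)
  note [measurable] = prefix_determined_measurable[OF H]
    prefix_determined_measurable[OF F] prefix_determined_measurable[OF miss]
  have le: "\<P>(\<omega> in M. ?A m \<omega>) \<le> \<P>(\<omega> in M. ?F m (trajectory \<omega>)) * ((1 - \<delta>) * q)" for m
  proof -
    have "\<P>(\<omega> in M. ?A m \<omega>) \<le> \<P>(\<omega> in M. ?miss m (trajectory \<omega>)) * q"
      by (rule later[OF miss])
    also have "\<dots> \<le> \<P>(\<omega> in M. ?F m (trajectory \<omega>)) * (1 - \<delta>) * q"
      using \<delta> \<open>0 \<le> q\<close> by (intro mult_right_mono prob_step_avoids_le[OF F]) (auto simp: first_entry_def)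
    finally show ?thesis by (simp add: mult.assoc)
  qed
  have "\<P>(\<omega> in M. H (trajectory \<omega>) \<and> always_misses G b n (trajectory \<omega>)) \<le> \<P>(\<omega> in M. \<exists>m. ?A m \<omega>)"
    by (rule finite_measure_mono, blast elim: always_misses_restart, measurable)
  also have "\<dots> \<le> \<P>(\<omega> in M. \<exists>m. ?F m (trajectory \<omega>)) * ((1 - \<delta>) * q)"
  proof (rule prob_Ex_disjoint_le_mult[OF _ _ _ _ _ le])
    show "m = m'" if "?F m (trajectory \<omega>)" "?F m' (trajectory \<omega>)" for m m' \<omega>
      using that first_entry_unique by blast
  qed (measurable, use \<delta>(2) \<open>0 \<le> q\<close> in simp_all)
  also have "\<dots> \<le> \<P>(\<omega> in M. H (trajectory \<omega>)) * ((1 - \<delta>) * q)"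
  proof (rule mult_right_mono)
    show "\<P>(\<omega> in M. \<exists>m. ?F m (trajectory \<omega>)) \<le> \<P>(\<omega> in M. H (trajectory \<omega>))"
      by (rule finite_measure_mono, blast, measurable)
  qed (use \<delta>(2) \<open>0 \<le> q\<close> in simp)
  finally show ?thesis .
qed

lemma prob_always_misses_le:
  assumes "prefix_determined n H" and \<delta>: "\<And>x. x \<in> G \<Longrightarrow> \<delta> \<le> p x b" "\<delta> \<le> 1"
  shows "\<P>(\<omega> in M. H (trajectory \<omega>) \<and> always_misses G b n (trajectory \<omega>)) \<le>
    \<P>(\<omega> in M. H (trajectory \<omega>)) * (1 - \<delta>) ^ j"
  using assms(1)
proof (induction j arbitrary: n H)
  case 0
  note [measurable] = prefix_determined_measurable[OF 0]
  have "\<P>(\<omega> in M. H (trajectory \<omega>) \<and> always_misses G b n (trajectory \<omega>)) \<le>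
      \<P>(\<omega> in M. H (trajectory \<omega>))"
    by (rule finite_measure_mono, blast, measurable)
  then show ?case by simp
next
  case (Suc j)
  then show ?case
    using prob_always_misses_restart_le[where q="(1 - \<delta>) ^ j", OF _ \<delta>] \<delta>(2) by simp
qed

lemma AE_step_infinitely_often:
  assumes \<delta>: "0 < \<delta>" "\<And>x. x \<in> G \<Longrightarrow> \<delta> \<le> p x b"
  shows "AE \<omega> in M. infinite {n. X n \<omega> \<in> G} \<longrightarrow> infinite {n. X n \<omega> \<in> G \<and> X (Suc n) \<omega> = b}"
proof -
  have "AE \<omega> in M. \<not> always_misses G b n (trajectory \<omega>)" for n
  proof -
    let ?q = "1 - min \<delta> 1"
    have "\<P>(\<omega> in M. always_misses G b n (trajectory \<omega>)) \<le> ?q ^ j" for j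
      using prob_always_misses_le[of n "\<lambda>_. True" G "min \<delta> 1" b j] \<delta>(2)
      by (force simp: prefix_determined_def prob_space)
    moreover have "(\<lambda>j. ?q ^ j) \<longlonglongrightarrow> 0"
      using \<delta>(1) by (intro LIMSEQ_power_zero) auto
    ultimately have "\<P>(\<omega> in M. always_misses G b n (trajectory \<omega>)) \<le> 0"
      by (intro LIMSEQ_le_const) auto
    then show ?thesis
      by (simp add: measure_le_0_iff prob_Collect_eq_0)
  qed
  then have "AE \<omega> in M. \<forall>n. \<not> always_misses G b n (trajectory \<omega>)"
    by (simp add: AE_all_countable)
  then show ?thesis
  proof eventually_elim
    case (elim \<omega>)
    show ?case
    proof (intro impI notI)
      assume inf: "infinite {n. X n \<omega> \<in> G}" and "finite {n. X n \<omega> \<in> G \<and> X (Suc n) \<omega> = b}"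
      then obtain n where "\<forall>k\<in>{n. X n \<omega> \<in> G \<and> X (Suc n) \<omega> = b}. k < n"
        by (meson finite_nat_set_iff_bounded)
      with inf have "always_misses G b n (trajectory \<omega>)"
        by (auto simp: always_misses_def)
      with elim show False by blast
    qed
  qed
qed

lemma AE_step_recurs:
  assumes g: "\<forall>x x'. g x = g x' \<longrightarrow> p x = p x'"
  shows "AE \<omega> in M. \<forall>a b. 0 < p a b \<longrightarrow> infinite {n. g (X n \<omega>) = g a} \<longrightarrow>
    infinite {n. g (X n \<omega>) = g a \<and> X (Suc n) \<omega> = b}"
  unfolding AE_all_countable
proof (intro allI)
  fix a b
  have "p a b \<le> p x b" if "x \<in> {x. g x = g a}" for x
    using that g[rule_format, of x a] by simp
  then show "AE \<omega> in M. 0 < p a b \<longrightarrow> infinite {n. g (X n \<omega>) = g a} \<longrightarrow>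
      infinite {n. g (X n \<omega>) = g a \<and> X (Suc n) \<omega> = b}"
    using AE_step_infinitely_often[of "p a b" "{x. g x = g a}" b] by (cases "0 < p a b") simp_all
qed

lemma AE_transition_pos: "AE \<omega> in M. \<forall>n. 0 < p (X n \<omega>) (X (Suc n) \<omega>)"
  unfolding AE_all_countable
proof
  fix n
  have "0 < p (fst w) (snd w)" if "\<P>(\<omega> in M. (X n \<omega>, X (Suc n) \<omega>) = w) > 0" for w
    using that prob_step[of n "\<lambda>_. True" "fst w" "snd w"]
    by (simp add: prefix_determined_def prod_eq_iff zero_less_mult_iff not_less transition_nonneg)
  then have "AE \<omega> in M. 0 < p (fst (X n \<omega>, X (Suc n) \<omega>)) (snd (X n \<omega>, X (Suc n) \<omega>))"
    by (intro AE_discreteI[where X="\<lambda>\<omega>. (X n \<omega>, X (Suc n) \<omega>)"] measurable_Pair_count_space) measurable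
  then show "AE \<omega> in M. 0 < p (X n \<omega>) (X (Suc n) \<omega>)"
    by simp
qed

lemma AE_recurrent_projection:
  assumes g: "\<forall>x x'. g x = g x' \<longrightarrow> p x = p x'"
    and start: "AE \<omega> in M. infinite {n. g (X n \<omega>) = g (X 0 \<omega>)}"
  shows "AE \<omega> in M. \<forall>n. infinite {m. g (X m \<omega>) = g (X n \<omega>)}"
  using AE_step_recurs[OF g] AE_transition_pos start
proof eventually_elim
  case (elim \<omega>)
  show ?case
  proof
    fix n show "infinite {m. g (X m \<omega>) = g (X n \<omega>)}"
    proof (induction n)
      case (Suc n)
      then have "infinite {m. g (X m \<omega>) = g (X n \<omega>) \<and> X (Suc m) \<omega> = X (Suc n) \<omega>}"
        using elim(1,2) by blast
      then have "infinite {m. X m \<omega> = X (Suc n) \<omega>}"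
        by (rule infinite_Collect_SucD)
      then show ?case
        by (rule infinite_super[rotated]) auto
    qed (use elim(3) in simp)
  qed
qed

end

section \<open>Homogeneous and recurrent chains\<close>

lemma ball_atLeastAtMost_shift: "(\<forall>k\<in>{m..m + n}. P k) \<longleftrightarrow> (\<forall>k\<le>n. P (m + k))" for m n :: nat
  by (auto dest!: le_Suc_ex)

lemma (in markov_process) pmf_embed_transition:
  assumes "\<P>(\<omega> in M. X n \<omega> = x) > 0"
  shows "pmf (embed_pmf (p x)) x' = p x x'"
proof (rule pmf_embed_pmf[OF transition_nonneg])
  have step: "\<P>(\<omega> in M. X n \<omega> = x \<and> X (Suc n) \<omega> = x') = \<P>(\<omega> in M. X n \<omega> = x) * p x x'" for x'
    using prob_step[of n "\<lambda>_. True" x x'] by (simp add: prefix_determined_def)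
  have "ennreal \<P>(\<omega> in M. X n \<omega> = x) = ennreal \<P>(\<omega> in M. \<exists>x'. X n \<omega> = x \<and> X (Suc n) \<omega> = x')"
    by simp
  also have "\<dots> = (\<integral>\<^sup>+x'. ennreal \<P>(\<omega> in M. X n \<omega> = x \<and> X (Suc n) \<omega> = x') \<partial>count_space UNIV)"
    by (rule prob_Ex_disjoint) auto
  also have "\<dots> = ennreal \<P>(\<omega> in M. X n \<omega> = x) * (\<integral>\<^sup>+x'. ennreal (p x x') \<partial>count_space UNIV)"
    by (simp add: step ennreal_mult transition_nonneg nn_integral_cmult)
  finally have "ennreal \<P>(\<omega> in M. X n \<omega> = x) * (\<integral>\<^sup>+x'. ennreal (p x x') \<partial>count_space UNIV) =
      ennreal \<P>(\<omega> in M. X n \<omega> = x) * 1"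
    by (simp only: mult_1_right)
  then show "(\<integral>\<^sup>+x'. ennreal (p x x') \<partial>count_space UNIV) = 1"
    using assms by (subst (asm) ennreal_mult_cancel_left) auto
qed

lemma homogeneous_markov_chainE:
  assumes chain: "homogeneous_markov_chain M n0 X"
  obtains p where "markov_process M (\<lambda>n. X (n0 + n)) p"
proof -
  interpret prob_space M
    using chain by (simp add: homogeneous_markov_chain_def discrete_process_def)
  have [measurable]: "X (n0 + n) \<in> M \<rightarrow>\<^sub>M count_space UNIV" for n
    using chain by (simp add: homogeneous_markov_chain_def discrete_process_def)
  obtain K where K: "\<P>(\<omega> in M. X (Suc n) \<omega> = x' \<bar> \<forall>k\<in>{n0..n}. X k \<omega> = x k) = pmf (K (x n)) x'"
    if "n0 \<le> n" "\<P>(\<omega> in M. \<forall>k\<in>{n0..n}. X k \<omega> = x k) > 0" for n x x'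
    using chain unfolding homogeneous_markov_chain_def by blast
  have "\<P>(\<omega> in M. \<forall>k\<le>Suc n. X (n0 + k) \<omega> = x k) =
      \<P>(\<omega> in M. \<forall>k\<le>n. X (n0 + k) \<omega> = x k) * pmf (K (x n)) (x (Suc n))" for n x
  proof -
    have "\<P>(\<omega> in M. X (Suc (n0 + n)) \<omega> = x (Suc n) \<bar> \<forall>k\<le>n. X (n0 + k) \<omega> = x k) =
        pmf (K (x n)) (x (Suc n))"
      if "\<P>(\<omega> in M. \<forall>k\<le>n. X (n0 + k) \<omega> = x k) > 0"
      using that K[of "n0 + n" "\<lambda>k. x (k - n0)" "x (Suc n)"] by (simp add: ball_atLeastAtMost_shift)
    then have "\<P>(\<omega> in M. X (Suc (n0 + n)) \<omega> = x (Suc n) \<and> (\<forall>k\<le>n. X (n0 + k) \<omega> = x k)) =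
        \<P>(\<omega> in M. \<forall>k\<le>n. X (n0 + k) \<omega> = x k) * pmf (K (x n)) (x (Suc n))"
      by (intro prob_conj_eq_mult) measurable
    moreover have "(\<forall>k\<le>Suc n. X (n0 + k) \<omega> = x k) \<longleftrightarrow>
        X (Suc (n0 + n)) \<omega> = x (Suc n) \<and> (\<forall>k\<le>n. X (n0 + k) \<omega> = x k)" for \<omega>
      by (auto simp: le_Suc_eq)
    ultimately show ?thesis by (simp only:)
  qed
  then have "markov_process M (\<lambda>n. X (n0 + n)) (\<lambda>x. pmf (K x))"
    by unfold_locales auto
  then show thesis by (rule that)
qed

lemma homogeneous_markov_chainI:
  assumes "markov_process M (\<lambda>n. X (n0 + n)) p"
  shows "homogeneous_markov_chain M n0 X"
proof -
  interpret markov_process M "\<lambda>n. X (n0 + n)" p by fact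
  have "\<P>(\<omega> in M. X (Suc (n0 + n)) \<omega> = x' \<bar> \<forall>k\<le>n. X (n0 + k) \<omega> = x (n0 + k)) =
      pmf (embed_pmf (p (x (n0 + n)))) x'"
    if pos: "\<P>(\<omega> in M. \<forall>k\<le>n. X (n0 + k) \<omega> = x (n0 + k)) > 0" for n x x'
  proof -
    let ?H = "\<lambda>u. \<forall>k\<le>n. u k = x (n0 + k)"
    have "prefix_determined n ?H" by (auto simp: prefix_determined_def)
    from prob_step[OF this, of "x (n0 + n)" x']
    moreover have "?H (\<lambda>k. X (n0 + k) \<omega>) \<and> X (n0 + n) \<omega> = x (n0 + n) \<longleftrightarrow> ?H (\<lambda>k. X (n0 + k) \<omega>)"
      "?H (\<lambda>k. X (n0 + k) \<omega>) \<and> X (n0 + n) \<omega> = x (n0 + n) \<and> X (n0 + Suc n) \<omega> = x' \<longleftrightarrow>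
        X (Suc (n0 + n)) \<omega> = x' \<and> ?H (\<lambda>k. X (n0 + k) \<omega>)" for \<omega>
      by auto
    ultimately have "\<P>(\<omega> in M. X (Suc (n0 + n)) \<omega> = x' \<and> ?H (\<lambda>k. X (n0 + k) \<omega>)) =
        \<P>(\<omega> in M. ?H (\<lambda>k. X (n0 + k) \<omega>)) * p (x (n0 + n)) x'"
      by (simp only:)
    moreover have "\<P>(\<omega> in M. X (n0 + n) \<omega> = x (n0 + n)) > 0"
      using pos by (rule less_le_trans) (rule finite_measure_mono, auto)
    ultimately show ?thesis
      using pos by (simp add: cond_prob_def pmf_embed_transition)
  qed
  moreover have "discrete_process M n0 X"
    unfolding discrete_process_def
    using prob_space_axioms measurable_state by (metis le_add_diff_inverse)
  ultimately show ?thesis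
    unfolding homogeneous_markov_chain_def
    by (intro conjI exI[of _ "\<lambda>x. embed_pmf (p x)"]) (auto simp: le_iff_add ball_atLeastAtMost_shift)
qed

lemma infinite_from_iff: "infinite {n. m \<le> n \<and> P n} \<longleftrightarrow> infinite {n. P (m + n)}" for m :: nat
proof -
  have "{n. m \<le> n \<and> P n} = (+) m ` {n. P (m + n)}"
    by (auto simp: le_iff_add)
  then show ?thesis by (simp add: finite_image_iff)
qed

lemma recurrent_chain_iff:
  fixes X :: "nat \<Rightarrow> 'a \<Rightarrow> 'x::countable"
  assumes X: "discrete_process M n0 X"
  shows "recurrent_chain M n0 X \<longleftrightarrow> (AE \<omega> in M. infinite {n. X (n0 + n) \<omega> = X n0 \<omega>})"
proof -
  interpret prob_space M using X by (simp add: discrete_process_def)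
  have [measurable]: "X (n0 + n) \<in> M \<rightarrow>\<^sub>M count_space UNIV" for n
    using X by (simp add: discrete_process_def)
  have [measurable]: "X n0 \<in> M \<rightarrow>\<^sub>M count_space UNIV"
    using X by (simp add: discrete_process_def)
  have [measurable]: "Measurable.pred M (\<lambda>\<omega>. infinite {n. X (n0 + n) \<omega> = x})" for x
    unfolding infinite_nat_iff_unbounded_le mem_Collect_eq by measurable
  have "recurrent_chain M n0 X \<longleftrightarrow> (\<forall>x. AE \<omega> in M. X n0 \<omega> = x \<longrightarrow> infinite {n. X (n0 + n) \<omega> = x})"
    unfolding recurrent_chain_def infinite_from_iff
    by (subst cond_prob_eq_1_iff_AE) measurable
  also have "\<dots> \<longleftrightarrow> (AE \<omega> in M. infinite {n. X (n0 + n) \<omega> = X n0 \<omega>})"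
    by (simp flip: AE_all_countable)
  finally show ?thesis .
qed

section \<open>Successors of the visits to a set\<close>

definition visit_successor :: "'w set \<Rightarrow> (nat \<Rightarrow> 'w) \<Rightarrow> nat \<Rightarrow> 'w option" where
  "visit_successor D u n =
     (let visits = {k. u k \<in> D} in
      if finite visits \<and> card visits < n then None
      else Some (u (Suc (enumerate visits (n - 1)))))"

lemma successor_eq_map_visit_successor:
  "successor (\<lambda>k. g (u k)) y n = map_option g (visit_successor {w. g w = y} u n)"
  by (simp add: successor_def visit_successor_def Let_def)

text \<open>Visits are counted from 0 here, but from 1 in \<open>visit_successor\<close>.\<close>

definition nth_visit :: "'w set \<Rightarrow> nat \<Rightarrow> nat \<Rightarrow> (nat \<Rightarrow> 'w) \<Rightarrow> bool" where
  "nth_visit D n m u \<longleftrightarrow> u m \<in> D \<and> card {k\<in>{..<m}. u k \<in> D} = n"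

lemma card_less_enumerate:
  fixes S :: "nat set"
  assumes "finite S \<Longrightarrow> n < card S"
  shows "card {k\<in>S. k < enumerate S n} = n"
proof -
  have index: "\<exists>i. (finite S \<longrightarrow> i < card S) \<and> enumerate S i = k" if "k \<in> S" for k
    using that finite_enumerate_Ex[of S k] enumerate_Ex[of S k] by blast
  have mono: "enumerate S i < enumerate S j \<longleftrightarrow> i < j"
    if "finite S \<longrightarrow> i < card S" "finite S \<longrightarrow> j < card S" for i j
    using that by (cases "finite S") simp_all
  have "{k\<in>S. k < enumerate S n} = enumerate S ` {..<n}"
  proof (intro equalityI subsetI)
    fix k assume "k \<in> {k\<in>S. k < enumerate S n}"
    then obtain i where "finite S \<longrightarrow> i < card S" "k = enumerate S i" "k < enumerate S n"
      using index by blast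
    then show "k \<in> enumerate S ` {..<n}"
      using mono assms by blast
  next
    fix k assume "k \<in> enumerate S ` {..<n}"
    then obtain i where i: "i < n" "k = enumerate S i" by blast
    then have "finite S \<longrightarrow> i < card S" using assms by auto
    then show "k \<in> {k\<in>S. k < enumerate S n}"
      using i mono assms by (cases "finite S") (simp_all add: enumerate_in_set finite_enumerate_in_set)
  qed
  moreover have "inj_on (enumerate S) {..<n}"
  proof (rule linorder_inj_onI')
    fix i j assume "i \<in> {..<n}" "j \<in> {..<n}" "i < j"
    then have "enumerate S i < enumerate S j" using assms by (intro mono[THEN iffD2]) auto
    then show "enumerate S i \<noteq> enumerate S j" by simp
  qed
  ultimately show ?thesis by (simp add: card_image)
qed

lemma nth_visit_iff_enumerate:
  "nth_visit D n m u \<longleftrightarrow> (finite {k. u k \<in> D} \<longrightarrow> n < card {k. u k \<in> D}) \<and> enumerate {k. u k \<in> D} n = m"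
    (is "_ \<longleftrightarrow> ?index n \<and> enumerate ?V n = m")
proof -
  have count: "card {k\<in>{..<enumerate ?V i}. u k \<in> D} = i" if "?index i" for i
    using card_less_enumerate[of ?V i] that by (simp add: conj_commute)
  show ?thesis
  proof
    assume visit: "nth_visit D n m u"
    then obtain i where "?index i" "enumerate ?V i = m"
      using finite_enumerate_Ex[of ?V m] enumerate_Ex[of ?V m] unfolding nth_visit_def by blast
    with visit count[of i] show "?index n \<and> enumerate ?V n = m"
      by (auto simp: nth_visit_def)
  next
    assume index: "?index n \<and> enumerate ?V n = m"
    then have "m \<in> ?V"
      using finite_enumerate_in_set[of ?V n] enumerate_in_set[of ?V n] by blast
    with index count[of n] show "nth_visit D n m u"
      by (auto simp: nth_visit_def)
  qed
qed

lemma nth_visit_unique: "nth_visit D n m u \<Longrightarrow> nth_visit D n m' u \<Longrightarrow> m = m'"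
  by (simp add: nth_visit_iff_enumerate)

lemma nth_visit_earlier:
  assumes "nth_visit D n m u" and "i < n"
  obtains j where "j < m" "nth_visit D i j u"
  using assms that[of "enumerate {k. u k \<in> D} i"]
  by (cases "finite {k. u k \<in> D}") (auto simp: nth_visit_iff_enumerate)

lemma nth_visit_add_iff:
  assumes "nth_visit D n m u"
  shows "nth_visit D (Suc (n + i)) (Suc m + j) u \<longleftrightarrow> nth_visit D i j (\<lambda>k. u (Suc m + k))"
proof -
  have "{k\<in>{..<Suc m + j}. u k \<in> D} =
      insert m ({k\<in>{..<m}. u k \<in> D} \<union> (+) (Suc m) ` {k\<in>{..<j}. u (Suc m + k) \<in> D})"
    (is "_ = insert m (?E \<union> ?L)")
  proof (intro equalityI subsetI)
    fix k assume "k \<in> {k\<in>{..<Suc m + j}. u k \<in> D}"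
    then show "k \<in> insert m (?E \<union> ?L)"
      by (cases k m rule: linorder_cases) (auto dest!: less_imp_Suc_add)
  qed (use assms in \<open>auto simp: nth_visit_def\<close>)
  moreover have "card (insert m (?E \<union> ?L)) = Suc (card ?E + card ?L)"
    by (subst card_insert_disjoint) (auto intro!: card_Un_disjoint)
  moreover have "card ?L = card {k\<in>{..<j}. u (Suc m + k) \<in> D}"
    by (rule card_image[OF inj_on_add])
  moreover have "card ?E = n"
    using assms by (simp add: nth_visit_def)
  ultimately have "card {k\<in>{..<Suc m + j}. u k \<in> D} = Suc (n + card {k\<in>{..<j}. u (Suc m + k) \<in> D})"
    by (simp only:)
  then show ?thesis
    unfolding nth_visit_def by (simp only: nat.inject add_left_cancel)
qed

lemma nth_visit_Suc_iff:
  assumes "nth_visit D n m u"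
  shows "nth_visit D (Suc n) m' u \<longleftrightarrow> (\<exists>j. m' = Suc m + j \<and> nth_visit D 0 j (\<lambda>k. u (Suc m + k)))"
proof
  assume visit: "nth_visit D (Suc n) m' u"
  obtain j where "j < m'" "nth_visit D n j u"
    using nth_visit_earlier[OF visit lessI] by blast
  then have "m < m'" using nth_visit_unique[OF assms] by blast
  then obtain j where "m' = Suc m + j" using less_imp_Suc_add by fastforce
  then show "\<exists>j. m' = Suc m + j \<and> nth_visit D 0 j (\<lambda>k. u (Suc m + k))"
    using visit nth_visit_add_iff[OF assms, of 0 j] by auto
qed (use nth_visit_add_iff[OF assms, of 0] in auto)

lemma visit_successor_eq_Some_iff:
  "visit_successor D u (Suc n) = Some w \<longleftrightarrow> (\<exists>m. nth_visit D n m u \<and> u (Suc m) = w)"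
  by (auto simp: visit_successor_def nth_visit_iff_enumerate Let_def)

lemma visit_successor_eq_None_iff: "visit_successor D u (Suc n) = None \<longleftrightarrow> (\<nexists>m. nth_visit D n m u)"
  by (auto simp: visit_successor_def nth_visit_iff_enumerate Let_def)

lemma visit_successor_None_mono:
  "visit_successor D u (Suc i) = None \<Longrightarrow> i \<le> n \<Longrightarrow> visit_successor D u (Suc n) = None"
  by (auto simp: visit_successor_def Let_def split: if_splits)

lemma visit_successor_restart:
  assumes "nth_visit D n m u"
  shows "visit_successor D u (Suc (Suc n)) = visit_successor D (\<lambda>k. u (Suc m + k)) (Suc 0)"
proof -
  have "visit_successor D u (Suc (Suc n)) = Some w \<longleftrightarrow>
      visit_successor D (\<lambda>k. u (Suc m + k)) (Suc 0) = Some w" for w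
    by (auto simp: visit_successor_eq_Some_iff nth_visit_Suc_iff[OF assms])
  then show ?thesis by (metis not_None_eq)
qed

lemma nth_visit_prefix_determined: "prefix_determined m (nth_visit D n m)"
  by (auto simp: prefix_determined_def nth_visit_def intro!: arg_cong[where f=card])

lemma visit_successor_measurable [measurable]:
  "(\<lambda>u. visit_successor D u (Suc n)) \<in> path_space \<rightarrow>\<^sub>M count_space (UNIV :: 'w::countable option set)"
proof -
  note [measurable] = prefix_determined_measurable[OF nth_visit_prefix_determined]
  have "Measurable.pred path_space (\<lambda>u :: nat \<Rightarrow> 'w. visit_successor D u (Suc n) = c)" for c
    by (cases c) (simp_all add: visit_successor_eq_Some_iff visit_successor_eq_None_iff)
  from Collect_in_sets_path_space[OF this] show ?thesis
    by (auto simp: measurable_count_space_eq2_countable vimage_def)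
qed

lemma successor_measurable:
  assumes "1 \<le> n"
  shows "(\<lambda>u. successor u y n) \<in> path_space \<rightarrow>\<^sub>M count_space (UNIV :: 's::countable option set)"
proof (cases n)
  case (Suc m)
  then show ?thesis
    using visit_successor_measurable[of "{y}" m] successor_eq_map_visit_successor[of "\<lambda>s. s" _ y n]
    by (simp add: option.map_ident)
qed (use assms in simp)

definition past_successors :: "'w set \<Rightarrow> (nat \<Rightarrow> 'w option) \<Rightarrow> nat \<Rightarrow> nat \<Rightarrow> (nat \<Rightarrow> 'w) \<Rightarrow> bool" where
  "past_successors D a n m u \<longleftrightarrow>
     nth_visit D n m u \<and> (\<forall>k<n. \<exists>j<m. nth_visit D k j u \<and> a k = Some (u (Suc j)))"

lemma past_successors_prefix_determined: "prefix_determined (Suc m) (past_successors D a n m)"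
  unfolding prefix_determined_def
proof (intro allI impI)
  fix u v :: "nat \<Rightarrow> 'a" assume eq: "\<forall>k\<le>Suc m. u k = v k"
  have "nth_visit D k j u \<longleftrightarrow> nth_visit D k j v" if "j \<le> m" for k j
    using eq that by (intro prefix_determinedD[OF nth_visit_prefix_determined]) simp
  with eq show "past_successors D a n m u \<longleftrightarrow> past_successors D a n m v"
    by (simp add: past_successors_def cong: conj_cong)
qed

lemma visit_successors_prefix_iff:
  assumes "a n = Some w"
  shows "(\<forall>k\<le>n. visit_successor D u (Suc k) = a k) \<longleftrightarrow>
    (\<exists>m. past_successors D a n m u \<and> u (Suc m) = w)"
proof
  assume succ: "\<forall>k\<le>n. visit_successor D u (Suc k) = a k"
  then obtain m where m: "nth_visit D n m u" "u (Suc m) = w"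
    using assms visit_successor_eq_Some_iff[of D u n w] by auto
  have "\<exists>j<m. nth_visit D k j u \<and> a k = Some (u (Suc j))" if k: "k < n" for k
  proof -
    obtain j where "j < m" "nth_visit D k j u"
      using nth_visit_earlier[OF m(1) k] by blast
    moreover have "visit_successor D u (Suc k) = a k" using succ k by simp
    ultimately show ?thesis by (metis visit_successor_eq_Some_iff)
  qed
  with m have "past_successors D a n m u \<and> u (Suc m) = w"
    by (simp add: past_successors_def)
  then show "\<exists>m. past_successors D a n m u \<and> u (Suc m) = w" ..
next
  assume "\<exists>m. past_successors D a n m u \<and> u (Suc m) = w"
  then show "\<forall>k\<le>n. visit_successor D u (Suc k) = a k"
    using assms unfolding past_successors_def by (metis le_less visit_successor_eq_Some_iff)
qed

context markov_process
begin

definition visit_transition :: "'w set \<Rightarrow> 'w option \<Rightarrow> 'w option \<Rightarrow> real" where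
  "visit_transition D a c = (case a of None \<Rightarrow> of_bool (c = None)
     | Some w \<Rightarrow> measure (law_from w) {u. visit_successor D u (Suc 0) = c})"

lemma prob_visit_successors_Suc:
  "\<P>(\<omega> in M. \<forall>k\<le>Suc n. visit_successor D (trajectory \<omega>) (Suc k) = a k) =
    \<P>(\<omega> in M. \<forall>k\<le>n. visit_successor D (trajectory \<omega>) (Suc k) = a k) *
    visit_transition D (a n) (a (Suc n))"
proof (cases "a n")
  case None
  then have absorbed: "(\<forall>k\<le>Suc n. visit_successor D u (Suc k) = a k) \<longleftrightarrow>
      (\<forall>k\<le>n. visit_successor D u (Suc k) = a k) \<and> a (Suc n) = None" for u
    using visit_successor_None_mono[of D u n "Suc n"] by (auto simp: le_Suc_eq)
  show ?thesis
    unfolding absorbed using None by (cases "a (Suc n)") (simp_all add: visit_transition_def)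
next
  case (Some w)
  note past_iff = visit_successors_prefix_iff[of a n w, OF Some]
  let ?restart = "\<lambda>u. visit_successor D u (Suc 0) = a (Suc n)"
  have present_iff: "(\<forall>k\<le>Suc n. visit_successor D u (Suc k) = a k) \<longleftrightarrow>
      (\<exists>m. (past_successors D a n m u \<and> u (Suc m) = w) \<and> ?restart (\<lambda>k. u (Suc m + k)))" for u
  proof -
    have "(\<forall>k\<le>Suc n. visit_successor D u (Suc k) = a k) \<longleftrightarrow>
        (\<exists>m. past_successors D a n m u \<and> u (Suc m) = w) \<and> visit_successor D u (Suc (Suc n)) = a (Suc n)"
      unfolding past_iff[symmetric] by (auto simp: le_Suc_eq)
    then show ?thesis
      using visit_successor_restart[of D n _ u] by (auto simp: past_successors_def)
  qed
  show ?thesis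
    unfolding present_iff past_iff visit_transition_def Some option.case
  proof (rule strong_markov_property[OF past_successors_prefix_determined])
    show "m = m'" if "past_successors D a n m u" "past_successors D a n m' u" for m m' u
      using that nth_visit_unique by (auto simp: past_successors_def)
  qed measurable
qed

lemma markov_process_visit_successor:
  "markov_process M (\<lambda>n \<omega>. visit_successor D (trajectory \<omega>) (Suc n)) (visit_transition D)"
proof
  show "0 \<le> visit_transition D a c" for a c
    by (simp add: visit_transition_def split: option.split)
qed (measurable, rule prob_visit_successors_Suc)

end

lemma infinite_visit_successor:
  assumes "infinite {m. u m \<in> D \<and> u (Suc m) = w}"
  shows "infinite {n. visit_successor D u (Suc n) = Some w}"
proof
  let ?S = "{m. u m \<in> D \<and> u (Suc m) = w}" and ?count = "\<lambda>m. card {k\<in>{..<m}. u k \<in> D}"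
  assume "finite {n. visit_successor D u (Suc n) = Some w}"
  moreover have "?count ` ?S \<subseteq> {n. visit_successor D u (Suc n) = Some w}"
    by (auto simp: visit_successor_eq_Some_iff nth_visit_def)
  moreover have "inj_on ?count ?S"
    by (rule inj_onI) (auto simp: nth_visit_def intro: nth_visit_unique[of D _ _ u])
  ultimately show False
    using assms by (meson finite_imageD finite_subset)
qed

lemma (in markov_process) AE_visit_successor_recurrent:
  assumes "AE \<omega> in M. infinite {n. X n \<omega> = X 0 \<omega>}"
  shows "AE \<omega> in M. infinite {n. visit_successor D (trajectory \<omega>) (Suc n) =
    visit_successor D (trajectory \<omega>) (Suc 0)}"
proof -
  have "\<forall>x x'. (x :: 'w) = x' \<longrightarrow> p x = p x'" by simp
  note AE_step_recurs[OF this] AE_recurrent_projection[OF this assms]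
  with AE_transition_pos show ?thesis
  proof eventually_elim
    case (elim \<omega>)
    let ?V = "visit_successor D (trajectory \<omega>)"
    show ?case
    proof (cases "?V (Suc 0)")
      case None
      then show ?thesis using visit_successor_None_mono[of D _ 0] by simp
    next
      case (Some w)
      then obtain m where m: "X m \<omega> \<in> D" "X (Suc m) \<omega> = w"
        by (auto simp: visit_successor_eq_Some_iff nth_visit_def)
      have "infinite {n. X n \<omega> = X m \<omega> \<and> X (Suc n) \<omega> = w}"
        using elim m(2) by blast
      then have "infinite {n. X n \<omega> \<in> D \<and> X (Suc n) \<omega> = w}"
        by (rule infinite_super[rotated]) (use m(1) in auto)
      then show ?thesis unfolding Some by (rule infinite_visit_successor)
    qed
  qed
qed

theorem visit_successors_recurrent_chain:
  fixes W :: "nat \<Rightarrow> 'a \<Rightarrow> 'w::countable"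
  assumes chain: "homogeneous_markov_chain M 0 W" and rec: "recurrent_chain M 0 W"
  shows "homogeneous_markov_chain M 1 (\<lambda>n \<omega>. visit_successor D (\<lambda>k. W k \<omega>) n)"
    and "recurrent_chain M 1 (\<lambda>n \<omega>. visit_successor D (\<lambda>k. W k \<omega>) n)"
proof -
  obtain p where "markov_process M W p"
    using homogeneous_markov_chainE[OF chain] by auto
  then interpret markov_process M W p .
  have "discrete_process M 0 W"
    using chain by (simp add: homogeneous_markov_chain_def)
  then have "AE \<omega> in M. infinite {n. W n \<omega> = W 0 \<omega>}"
    using rec by (simp add: recurrent_chain_iff)
  note succ_rec = AE_visit_successor_recurrent[OF this]
  show "homogeneous_markov_chain M 1 (\<lambda>n \<omega>. visit_successor D (\<lambda>k. W k \<omega>) n)"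
    by (rule homogeneous_markov_chainI[where p="visit_transition D"])
      (simp add: markov_process_visit_successor)
  then have "discrete_process M 1 (\<lambda>n \<omega>. visit_successor D (\<lambda>k. W k \<omega>) n)"
    by (simp add: homogeneous_markov_chain_def)
  then show "recurrent_chain M 1 (\<lambda>n \<omega>. visit_successor D (\<lambda>k. W k \<omega>) n)"
    using succ_rec by (simp add: recurrent_chain_iff)
qed

section \<open>Hidden Markov models\<close>

lemma discrete_process_imp_measurable:
  "discrete_process M n0 X \<Longrightarrow> n0 \<le> n \<Longrightarrow> X n \<in> M \<rightarrow>\<^sub>M count_space UNIV"
  by (simp add: discrete_process_def)

lemma hidden_markov_pair_function:
  fixes X :: "nat \<Rightarrow> 'a \<Rightarrow> 'x::countable" and g :: "'x \<Rightarrow> 'r::countable"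
  assumes chain: "homogeneous_markov_chain M n0 X"
  shows "hidden_markov_pair M n0 X (\<lambda>n \<omega>. g (X n \<omega>))"
proof -
  have X: "discrete_process M n0 X"
    using chain by (simp add: homogeneous_markov_chain_def)
  then interpret prob_space M by (simp add: discrete_process_def)
  have single: "\<P>(\<omega> in M. g (X n \<omega>) \<in> B \<bar> X n \<omega> = x) = of_bool (g x \<in> B)"
    if "\<P>(\<omega> in M. X n \<omega> = x) > 0" for n x B
    by (rule cond_prob_const[OF that]) simp
  have "\<P>(\<omega> in M. \<forall>n\<in>{n0..m}. g (X n \<omega>) \<in> A n \<bar> \<forall>n\<in>{n0..m}. X n \<omega> = x n) =
      (\<Prod>n=n0..m. \<P>(\<omega> in M. g (X n \<omega>) \<in> A n \<bar> X n \<omega> = x n))"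
    if pos: "\<P>(\<omega> in M. \<forall>n\<in>{n0..m}. X n \<omega> = x n) > 0" for m A x
  proof -
    have "\<P>(\<omega> in M. X n \<omega> = x n) > 0" if "n \<in> {n0..m}" for n
    proof -
      have [measurable]: "X n \<in> M \<rightarrow>\<^sub>M count_space UNIV"
        using X that by (simp add: discrete_process_imp_measurable)
      show ?thesis
        using pos by (rule less_le_trans) (rule finite_measure_mono, use that in auto)
    qed
    then have "(\<Prod>n=n0..m. \<P>(\<omega> in M. g (X n \<omega>) \<in> A n \<bar> X n \<omega> = x n)) =
        (\<Prod>n=n0..m. of_bool (g (x n) \<in> A n))"
      by (intro prod.cong refl single) simp
    also have "\<dots> = of_bool (\<forall>n\<in>{n0..m}. g (x n) \<in> A n)"
      by (auto simp: prod_zero_iff intro!: prod.neutral)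
    also have "\<dots> = \<P>(\<omega> in M. \<forall>n\<in>{n0..m}. g (X n \<omega>) \<in> A n \<bar> \<forall>n\<in>{n0..m}. X n \<omega> = x n)"
      by (rule cond_prob_const[OF pos, symmetric]) simp
    finally show ?thesis ..
  qed
  moreover have "\<exists>f :: 'x \<Rightarrow> 'r pmf. \<forall>n\<ge>n0. \<forall>x B. \<P>(\<omega> in M. X n \<omega> = x) > 0 \<longrightarrow>
        \<P>(\<omega> in M. g (X n \<omega>) \<in> B \<bar> X n \<omega> = x) = measure_pmf.prob (f x) B"
    by (rule exI[of _ "\<lambda>x. return_pmf (g x)"]) (simp add: single indicator_def)
  moreover have "discrete_process M n0 (\<lambda>n \<omega>. g (X n \<omega>))"
    using X measurable_compose[of _ M "count_space UNIV" g] by (simp add: discrete_process_def)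
  ultimately show ?thesis
    unfolding hidden_markov_pair_def using chain by blast
qed

locale hidden_markov_process = markov_process M X p
  for M :: "'a measure" and X :: "nat \<Rightarrow> 'a \<Rightarrow> 'x::countable" and p +
  fixes Z :: "nat \<Rightarrow> 'a \<Rightarrow> 'r::countable" and f :: "'x \<Rightarrow> 'r pmf"
  assumes measurable_readout [measurable]: "Z n \<in> M \<rightarrow>\<^sub>M count_space UNIV"
    and prob_joint: "\<P>(\<omega> in M. \<forall>k\<le>n. X k \<omega> = x k \<and> Z k \<omega> = z k) =
      \<P>(\<omega> in M. \<forall>k\<le>n. X k \<omega> = x k) * (\<Prod>k\<le>n. pmf (f (x k)) (z k))"

lemma hidden_markov_pair_cond_prob:
  assumes pair: "hidden_markov_pair M n0 X Z"
  obtains f where "\<And>n x z. \<P>(\<omega> in M. \<forall>k\<le>n. X (n0 + k) \<omega> = x k) > 0 \<Longrightarrow>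
    \<P>(\<omega> in M. \<forall>k\<le>n. Z (n0 + k) \<omega> = z k \<bar> \<forall>k\<le>n. X (n0 + k) \<omega> = x k) =
    (\<Prod>k\<le>n. pmf (f (x k)) (z k))"
proof -
  have X: "discrete_process M n0 X"
    using pair by (simp add: hidden_markov_pair_def homogeneous_markov_chain_def)
  then interpret prob_space M by (simp add: discrete_process_def)
  have [measurable]: "X (n0 + n) \<in> M \<rightarrow>\<^sub>M count_space UNIV" for n
    using X by (simp add: discrete_process_imp_measurable)
  have indep: "\<P>(\<omega> in M. \<forall>k\<in>{n0..m}. Z k \<omega> \<in> A k \<bar> \<forall>k\<in>{n0..m}. X k \<omega> = x k) =
      (\<Prod>k=n0..m. \<P>(\<omega> in M. Z k \<omega> \<in> A k \<bar> X k \<omega> = x k))"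
    if "n0 \<le> m" "\<P>(\<omega> in M. \<forall>k\<in>{n0..m}. X k \<omega> = x k) > 0" for m x A
    using pair that unfolding hidden_markov_pair_def by blast
  obtain f where f: "\<P>(\<omega> in M. Z n \<omega> \<in> B \<bar> X n \<omega> = x) = measure_pmf.prob (f x) B"
    if "n0 \<le> n" "\<P>(\<omega> in M. X n \<omega> = x) > 0" for n x B
    using pair unfolding hidden_markov_pair_def by blast
  have "\<P>(\<omega> in M. \<forall>k\<le>n. Z (n0 + k) \<omega> = z k \<bar> \<forall>k\<le>n. X (n0 + k) \<omega> = x k) = (\<Prod>k\<le>n. pmf (f (x k)) (z k))"
    if pos: "\<P>(\<omega> in M. \<forall>k\<le>n. X (n0 + k) \<omega> = x k) > 0" for n x z
  proof -
    let ?x = "\<lambda>k. x (k - n0)" and ?A = "\<lambda>k. {z (k - n0)}"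
    have "\<P>(\<omega> in M. \<forall>k\<in>{n0..n0 + n}. Z k \<omega> \<in> ?A k \<bar> \<forall>k\<in>{n0..n0 + n}. X k \<omega> = ?x k) =
        (\<Prod>k=n0..n0 + n. \<P>(\<omega> in M. Z k \<omega> \<in> ?A k \<bar> X k \<omega> = ?x k))"
      using indep[of "n0 + n" ?x ?A] pos by (simp add: ball_atLeastAtMost_shift)
    also have "\<dots> = (\<Prod>k\<le>n. \<P>(\<omega> in M. Z (n0 + k) \<omega> \<in> {z k} \<bar> X (n0 + k) \<omega> = x k))"
      by (simp add: prod.atLeastAtMost_shift_0 atLeast0AtMost)
    also have "\<dots> = (\<Prod>k\<le>n. pmf (f (x k)) (z k))"
    proof (intro prod.cong refl)
      fix k assume "k \<in> {..n}"
      then have "\<P>(\<omega> in M. X (n0 + k) \<omega> = x k) > 0"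
        using pos by (elim less_le_trans) (rule finite_measure_mono, auto)
      then show "\<P>(\<omega> in M. Z (n0 + k) \<omega> \<in> {z k} \<bar> X (n0 + k) \<omega> = x k) = pmf (f (x k)) (z k)"
        using f[of "n0 + k" "x k" "{z k}"] by (simp add: measure_pmf_single)
    qed
    finally show ?thesis
      by (simp add: ball_atLeastAtMost_shift)
  qed
  then show thesis by (rule that)
qed

lemma hidden_markov_pairE:
  assumes pair: "hidden_markov_pair M n0 X Z"
  obtains p f where "hidden_markov_process M (\<lambda>n. X (n0 + n)) p (\<lambda>n. Z (n0 + n)) f"
proof -
  have Z: "discrete_process M n0 Z" and chain: "homogeneous_markov_chain M n0 X"
    using pair by (auto simp: hidden_markov_pair_def)
  obtain p where "markov_process M (\<lambda>n. X (n0 + n)) p"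
    using homogeneous_markov_chainE[OF chain] .
  then interpret markov_process M "\<lambda>n. X (n0 + n)" p .
  obtain f where f: "\<P>(\<omega> in M. \<forall>k\<le>n. Z (n0 + k) \<omega> = z k \<bar> \<forall>k\<le>n. X (n0 + k) \<omega> = x k) =
      (\<Prod>k\<le>n. pmf (f (x k)) (z k))" if "\<P>(\<omega> in M. \<forall>k\<le>n. X (n0 + k) \<omega> = x k) > 0" for n x z
    using hidden_markov_pair_cond_prob[OF pair] by blast
  have "\<P>(\<omega> in M. \<forall>k\<le>n. X (n0 + k) \<omega> = x k \<and> Z (n0 + k) \<omega> = z k) =
      \<P>(\<omega> in M. \<forall>k\<le>n. X (n0 + k) \<omega> = x k) * (\<Prod>k\<le>n. pmf (f (x k)) (z k))" for n x z
  proof -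
    have "(\<forall>k\<le>n. X (n0 + k) \<omega> = x k \<and> Z (n0 + k) \<omega> = z k) \<longleftrightarrow>
        (\<forall>k\<le>n. Z (n0 + k) \<omega> = z k) \<and> (\<forall>k\<le>n. X (n0 + k) \<omega> = x k)" for \<omega>
      by blast
    then show ?thesis
      using prob_conj_eq_mult[OF _ f] by simp
  qed
  then have "hidden_markov_process M (\<lambda>n. X (n0 + n)) p (\<lambda>n. Z (n0 + n)) f"
    using Z by unfold_locales (simp_all add: discrete_process_imp_measurable)
  then show thesis by (rule that)
qed

definition pair_transition :: "('x \<Rightarrow> 'x \<Rightarrow> real) \<Rightarrow> ('x \<Rightarrow> 'r pmf) \<Rightarrow> 'x \<times> 'r \<Rightarrow> 'x \<times> 'r \<Rightarrow> real" where
  "pair_transition p f w w' = p (fst w) (fst w') * pmf (f (fst w')) (snd w')"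

context hidden_markov_process
begin

lemma markov_process_pair: "markov_process M (\<lambda>n \<omega>. (X n \<omega>, Z n \<omega>)) (pair_transition p f)"
proof
  show "(\<lambda>\<omega>. (X n \<omega>, Z n \<omega>)) \<in> M \<rightarrow>\<^sub>M count_space UNIV" for n
    by (intro measurable_Pair_count_space) measurable
  show "0 \<le> pair_transition p f w w'" for w w'
    by (simp add: pair_transition_def transition_nonneg)
  show "\<P>(\<omega> in M. \<forall>k\<le>Suc n. (X k \<omega>, Z k \<omega>) = w k) =
      \<P>(\<omega> in M. \<forall>k\<le>n. (X k \<omega>, Z k \<omega>) = w k) * pair_transition p f (w n) (w (Suc n))" for n w
    by (simp add: prod_eq_iff prob_joint prob_prefix_Suc pair_transition_def)
qed

lemma AE_initial_readout_pos: "AE \<omega> in M. 0 < pmf (f (X 0 \<omega>)) (Z 0 \<omega>)"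
proof -
  have "0 < pmf (f (fst w)) (snd w)" if "\<P>(\<omega> in M. (X 0 \<omega>, Z 0 \<omega>) = w) > 0" for w
    using that prob_joint[of 0 "\<lambda>_. fst w" "\<lambda>_. snd w"]
    by (simp add: prod_eq_iff zero_less_mult_iff not_less)
  then have "AE \<omega> in M. 0 < pmf (f (fst (X 0 \<omega>, Z 0 \<omega>))) (snd (X 0 \<omega>, Z 0 \<omega>))"
    by (intro AE_discreteI[where X="\<lambda>\<omega>. (X 0 \<omega>, Z 0 \<omega>)"] measurable_Pair_count_space) measurable
  then show ?thesis
    by simp
qed

text \<open>The initial state has positive probability of being entered from any predecessor of a return of
  \<open>X\<close> to \<open>X 0\<close>, and the hidden part of that predecessor recurs.\<close>

lemma AE_pair_recurrent:
  assumes rec: "AE \<omega> in M. infinite {n. X n \<omega> = X 0 \<omega>}"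
  shows "AE \<omega> in M. infinite {n. (X n \<omega>, Z n \<omega>) = (X 0 \<omega>, Z 0 \<omega>)}"
proof -
  interpret pair: markov_process M "\<lambda>n \<omega>. (X n \<omega>, Z n \<omega>)" "pair_transition p f"
    by (rule markov_process_pair)
  have hidden: "\<forall>w w' :: 'x \<times> 'r. fst w = fst w' \<longrightarrow> pair_transition p f w = pair_transition p f w'"
    by (simp add: pair_transition_def fun_eq_iff)
  have start: "AE \<omega> in M. infinite {n. fst (X n \<omega>, Z n \<omega>) = fst (X 0 \<omega>, Z 0 \<omega>)}"
    using rec by simp
  show ?thesis
    using pair.AE_step_recurs[OF hidden] pair.AE_recurrent_projection[OF hidden start] rec
      AE_transition_pos AE_initial_readout_pos
  proof eventually_elim
    case (elim \<omega>)
    obtain m where m: "X (Suc m) \<omega> = X 0 \<omega>"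
    proof -
      from elim(3) obtain n where "n \<ge> 1" "X n \<omega> = X 0 \<omega>"
        by (auto simp: infinite_nat_iff_unbounded_le)
      then show thesis using that by (cases n) auto
    qed
    have "0 < pair_transition p f (X m \<omega>, Z m \<omega>) (X 0 \<omega>, Z 0 \<omega>)"
      using elim(4)[rule_format, of m] elim(5) m by (simp add: pair_transition_def)
    then have "infinite {n. fst (X n \<omega>, Z n \<omega>) = fst (X m \<omega>, Z m \<omega>) \<and>
        (X (Suc n) \<omega>, Z (Suc n) \<omega>) = (X 0 \<omega>, Z 0 \<omega>)}"
      using elim(1,2) by blast
    then show ?case
      by (rule infinite_Collect_SucD)
  qed
qed

end

theorem hidden_markov_pair_recurrent_chain:
  assumes pair: "hidden_markov_pair M n0 X Z" and rec: "recurrent_chain M n0 X"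
  shows "homogeneous_markov_chain M n0 (\<lambda>n \<omega>. (X n \<omega>, Z n \<omega>))"
    and "recurrent_chain M n0 (\<lambda>n \<omega>. (X n \<omega>, Z n \<omega>))"
proof -
  obtain p f where "hidden_markov_process M (\<lambda>n. X (n0 + n)) p (\<lambda>n. Z (n0 + n)) f"
    using hidden_markov_pairE[OF pair] .
  then interpret hidden_markov_process M "\<lambda>n. X (n0 + n)" p "\<lambda>n. Z (n0 + n)" f .
  have X: "discrete_process M n0 X"
    using pair by (simp add: hidden_markov_pair_def homogeneous_markov_chain_def)
  show "homogeneous_markov_chain M n0 (\<lambda>n \<omega>. (X n \<omega>, Z n \<omega>))"
    using markov_process_pair by (rule homogeneous_markov_chainI)
  then have W: "discrete_process M n0 (\<lambda>n \<omega>. (X n \<omega>, Z n \<omega>))"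
    by (simp add: homogeneous_markov_chain_def)
  show "recurrent_chain M n0 (\<lambda>n \<omega>. (X n \<omega>, Z n \<omega>))"
    using AE_pair_recurrent rec unfolding recurrent_chain_iff[OF W] recurrent_chain_iff[OF X] by simp
qed

section \<open>Equality of path laws\<close>

lemma discrete_process_imp_measurable_path:
  "discrete_process M 0 X \<Longrightarrow> (\<lambda>\<omega> k. X k \<omega>) \<in> M \<rightarrow>\<^sub>M path_space"
  by (rule measurable_abs_UNIV) (simp add: discrete_process_def)

lemma measure_path_law_cylinder:
  fixes X :: "nat \<Rightarrow> 'a \<Rightarrow> 'x::countable"
  assumes X: "discrete_process M 0 X"
  shows "measure (distr M path_space (\<lambda>\<omega> k. X k \<omega>)) {u. \<forall>k\<le>n. u k = v k} =
    measure (distr M (Pi\<^sub>M {..n} (\<lambda>_. count_space UNIV)) (\<lambda>\<omega>. \<lambda>k\<in>{..n}. X k \<omega>)) {\<lambda>k\<in>{..n}. v k}"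
proof -
  have "(\<lambda>\<omega>. \<lambda>k\<in>{..n}. X k \<omega>) \<in> M \<rightarrow>\<^sub>M Pi\<^sub>M {..n} (\<lambda>_. count_space UNIV)"
    using X by (intro measurable_restrict) (simp add: discrete_process_def)
  moreover have "Pi\<^sub>E {..n} (\<lambda>k. {v k}) = {\<lambda>k\<in>{..n}. v k}"
    by (simp add: PiE_eq_singleton)
  moreover have "Pi\<^sub>E {..n} (\<lambda>k. {v k}) \<in> sets (Pi\<^sub>M {..n} (\<lambda>_. count_space UNIV))"
    by (rule sets_PiM_I_finite) simp_all
  moreover have "(\<lambda>k\<in>{..n}. X k \<omega>) = (\<lambda>k\<in>{..n}. v k) \<longleftrightarrow> (\<forall>k\<le>n. X k \<omega> = v k)" for \<omega>
    by (auto simp: fun_eq_iff restrict_def)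
  ultimately show ?thesis
    using discrete_process_imp_measurable_path[OF X]
    by (simp add: measure_distr Collect_in_sets_path_space vimage_def)
qed

lemma path_law_eqI:
  fixes Y :: "nat \<Rightarrow> 'a \<Rightarrow> 'r::countable" and Z :: "nat \<Rightarrow> 'b \<Rightarrow> 'r"
  assumes Y: "discrete_process M 0 Y" and Z: "discrete_process N 0 Z"
    and fdd: "same_finite_dim_distributions 0 M Y N Z"
  shows "distr M path_space (\<lambda>\<omega> k. Y k \<omega>) = distr N path_space (\<lambda>\<omega> k. Z k \<omega>)"
proof (rule path_measure_eqI)
  show "prob_space (distr M path_space (\<lambda>\<omega> k. Y k \<omega>))"
    "prob_space (distr N path_space (\<lambda>\<omega> k. Z k \<omega>))"
    using Y Z by (auto simp: discrete_process_def intro!: prob_space.prob_space_distr measurable_abs_UNIV)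
  have "distr M (Pi\<^sub>M {..n} (\<lambda>_. count_space UNIV)) (\<lambda>\<omega>. \<lambda>k\<in>{..n}. Y k \<omega>) =
      distr N (Pi\<^sub>M {..n} (\<lambda>_. count_space UNIV)) (\<lambda>\<omega>. \<lambda>k\<in>{..n}. Z k \<omega>)" for n
    using fdd by (simp add: same_finite_dim_distributions_def)
  then show "measure (distr M path_space (\<lambda>\<omega> k. Y k \<omega>)) {u. \<forall>k\<le>n. u k = v k} =
      measure (distr N path_space (\<lambda>\<omega> k. Z k \<omega>)) {u. \<forall>k\<le>n. u k = v k}" for n v
    by (simp only: measure_path_law_cylinder[OF Y] measure_path_law_cylinder[OF Z])
qed simp_all

lemma same_finite_dim_distributions_path_functional:
  fixes F :: "nat \<Rightarrow> (nat \<Rightarrow> 'r::countable) \<Rightarrow> 'b::countable"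
  assumes Y: "discrete_process M 0 Y" and Z: "discrete_process N 0 Z"
    and fdd: "same_finite_dim_distributions 0 M Y N Z"
    and F: "\<And>n. n0 \<le> n \<Longrightarrow> F n \<in> path_space \<rightarrow>\<^sub>M count_space UNIV"
  shows "same_finite_dim_distributions n0 M (\<lambda>n \<omega>. F n (\<lambda>k. Y k \<omega>)) N (\<lambda>n \<omega>. F n (\<lambda>k. Z k \<omega>))"
  unfolding same_finite_dim_distributions_def
proof (intro allI impI)
  fix J :: "nat set" assume J: "finite J \<and> J \<subseteq> {n0..}"
  let ?P = "Pi\<^sub>M J (\<lambda>_. count_space UNIV) :: (nat \<Rightarrow> 'b) measure"
  have F_J: "(\<lambda>u. \<lambda>n\<in>J. F n u) \<in> path_space \<rightarrow>\<^sub>M ?P"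
    using J F by (intro measurable_restrict) auto
  have "distr M ?P (\<lambda>\<omega>. \<lambda>n\<in>J. F n (\<lambda>k. Y k \<omega>)) =
      distr (distr M path_space (\<lambda>\<omega> k. Y k \<omega>)) ?P (\<lambda>u. \<lambda>n\<in>J. F n u)"
    by (simp add: distr_distr[OF F_J discrete_process_imp_measurable_path[OF Y]] comp_def)
  also have "\<dots> = distr N ?P (\<lambda>\<omega>. \<lambda>n\<in>J. F n (\<lambda>k. Z k \<omega>))"
    unfolding path_law_eqI[OF Y Z fdd]
    by (simp add: distr_distr[OF F_J discrete_process_imp_measurable_path[OF Z]] comp_def)
  finally show "distr M ?P (\<lambda>\<omega>. \<lambda>n\<in>J. F n (\<lambda>k. Y k \<omega>)) = distr N ?P (\<lambda>\<omega>. \<lambda>n\<in>J. F n (\<lambda>k. Z k \<omega>))" .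
qed

theorem proposition3p1:
  fixes M :: "'a measure" and Y :: "nat \<Rightarrow> 'a \<Rightarrow> 's::countable"
  assumes "recurrent_hidden_markov_model M 0 Y"
  shows "\<forall>y. recurrent_hidden_markov_model M 1 (successors_array Y y)"
proof
  fix y
  obtain N :: "(nat \<Rightarrow> nat \<times> 's) measure" and X :: "nat \<Rightarrow> _ \<Rightarrow> nat" and Z where
    Y: "discrete_process M 0 Y" and pair: "hidden_markov_pair N 0 X Z"
    and rec: "recurrent_chain N 0 X" and fdd: "same_finite_dim_distributions 0 M Y N Z"
    using assms unfolding recurrent_hidden_markov_model_def by blast
  let ?U = "\<lambda>n \<omega>. visit_successor {w. snd w = y} (\<lambda>k. (X k \<omega>, Z k \<omega>)) n"
  note U = visit_successors_recurrent_chain[OF hidden_markov_pair_recurrent_chain[OF pair rec]]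
  have "successors_array Z y = (\<lambda>n \<omega>. map_option snd (?U n \<omega>))"
    by (simp add: successors_array_def fun_eq_iff flip: successor_eq_map_visit_successor)
  then have "hidden_markov_pair N 1 ?U (successors_array Z y)"
    using hidden_markov_pair_function[OF U(1), where g="map_option snd"] by simp
  moreover have "same_finite_dim_distributions 1 M (successors_array Y y) N (successors_array Z y)"
    using pair same_finite_dim_distributions_path_functional[OF Y _ fdd successor_measurable]
    by (simp add: hidden_markov_pair_def successors_array_def[abs_def])
  moreover have "discrete_process M 1 (successors_array Y y)"
    using Y measurable_compose[OF discrete_process_imp_measurable_path[OF Y] successor_measurable]
    by (simp add: discrete_process_def successors_array_def[abs_def])
  ultimately show "recurrent_hidden_markov_model M 1 (successors_array Y y)"
    using U(2) by (intro recurrent_hidden_markov_modelI)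
qed

end
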